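(* The class of simplicial oplax $3$-morphisms is stable under composition: if $A$, $B$, $C$ are small strict $3$-categories and $F\colon N_\infty(A)\to N_\infty(B)$ and $G\colon N_\infty(B)\to N_\infty(C)$ are simplicial oplax $3$-morphisms, then the composite morphism of simplicial sets $GF\colon N_\infty(A)\to N_\infty(C)$ is a simplicial oplax $3$-morphism.
   Context: Conventions. A $3$-category is regarded as a strict $\infty$-category whose cells of dimension $>3$ are identities. $y*_i x$ denotes composition along $i$-cells, defined when the $i$-target of $x$ equals the $i$-source of $y$; $1_x$ is the identity of $x$; a cell is trivial if it is an identity. Cells of different dimensions are composed by whiskering. $*_0$ binds tighter than $*_1$. We write $gf$, ... for $*_0$-compositions. Orientals and Street nerve. Let $C(n)$ be the chain complex with $C(n)_p$ free abelian on the strictly increasing tuples $(i_0,\dots,i_p)$ in $\{0,\dots,n\}$, $d(i_0,\dots,i_p)=\sum_k(-1)^k(i_0,\dots,\widehat{i_k},\dots,i_p)$, augmentation $e(i)=1$, and let $C(n)_p^*$ be the submonoid generated by the basis. The $n$-th oriental $\mathcal O_n$ is the strict $\infty$-category whose $k$-cells are families $x=(x^\varepsilon_p)_{0\le p\le k,\,\varepsilon\in\{0,1\}}$ with $x^\varepsilon_p\in C(n)^*_p$, $d(x^\varepsilon_p)=x^1_{p-1}-x^0_{p-1}$ for $p>0$, $e(x^\varepsilon_0)=1$, $x^0_k=x^1_k$. The source (resp. target) of $x$ is obtained by deleting the entries of degree $k$ and replacing both entries of degree $k-1$ by $x^0_{k-1}$ (resp. $x^1_{k-1}$); identities are obtained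 by adding a zero column; $(x*_jy)^0_p=y^0_p$, $(x*_jy)^1_p=x^1_p$ for $p\le j$, and $(x*_jy)^\varepsilon_p=x^\varepsilon_p+y^\varepsilon_p$ for $p>j$. The atom $\langle i_0\dots i_p\rangle$ is the $p$-cell with top entry $(i_0,\dots,i_p)$ and lower entries $x^0_{k-1}=(dx^0_k)_-$, $x^1_{k-1}=(dx^1_k)_+$ (negative/positive parts). The $\mathcal O_n$ form a cosimplicial object, and the Street nerve is $N_\infty(B)_n=\mathrm{Hom}_{\infty\text{-}\mathrm{Cat}}(\mathcal O_n,B)$. Low-dimensional simplices. A $2$-simplex of $N_\infty(A)$ amounts to $1$-cells $f_{01},f_{12},f_{02}$ and a $2$-cell $\alpha_{012}\colon f_{02}\to f_{12}*_0f_{01}$. A $3$-simplex amounts to $1$-cells $f_{ij}$ ($0\le i<j\le3$), $2$-cells $\alpha_{ijk}\colon f_{ik}\to f_{jk}*_0f_{ij}$ and a $3$-cell $f_{23}*_0\alpha_{012}*_1\alpha_{023}\to\alpha_{123}*_0f_{01}*_1\alpha_{013}$. The $2$-cell (resp. $3$-cell) is called the principal cell of the simplex. Definition. Let $A,B$ be small $3$-categories. A morphism of simplicial sets $F\colon N_\infty(A)\to N_\infty(B)$ is a simplicial oplax $3$-morphism if: (i) for every $2$-cell $\alpha\colon f\to g$ of $A$ with $f,g\colon a\to a'$, the image under $F$ of the $3$-simplex with $f_{01}=1_a$, $f_{12}=g$, $f_{23}=1_{a'}$, $f_{02}=f_{13}=f_{03}=f$, $\alpha_{012}=\alpha_{123}=\alpha$,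 $\alpha_{023}=\alpha_{013}=1_f$ and trivial principal $3$-cell has trivial principal $3$-cell; (ii) for every $2$-cell $\alpha\colon f\to h*_0g$ of $A$, with $g\colon a\to a'$, $h\colon a'\to a''$, the image under $F$ of the $3$-simplex with $f_{01}=1_a$, $f_{12}=f_{02}=g$, $f_{23}=h$, $f_{03}=f$, $f_{13}=hg$, $\alpha_{012}=1_g$, $\alpha_{123}=1_{hg}$, $\alpha_{023}=\alpha_{013}=\alpha$ and trivial principal $3$-cell has trivial principal $3$-cell; (iii) for every pair of $2$-cells $\alpha\colon f\to g$, $\beta\colon g\to i*_0h$ of $A$, with $h\colon a\to a'$, $i\colon a'\to a''$, the image under $F$ of the $3$-simplex with $f_{01}=h$, $f_{12}=f_{13}=i$, $f_{23}=1_{a''}$, $f_{03}=f$, $f_{02}=g$, $\alpha_{012}=\beta$, $\alpha_{023}=\alpha$, $\alpha_{013}=\beta*_1\alpha$, $\alpha_{123}=1_i$ and trivial principal $3$-cell has trivial principal $3$-cell. *)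

theory Defs
  imports "HOL-Library.FuncSet" "HOL-Algebra.Free_Abelian_Groups"
begin

section \<open>Strict infinity-categories\<close>

text \<open>
  A \<open>(Suc k)\<close>-cell \<open>x\<close> has the \<open>k\<close>-cells \<open>src C k x\<close> and \<open>tgt C k x\<close> as its source and target,
  and a \<open>k\<close>-cell \<open>x\<close> has the \<open>(Suc k)\<close>-cell \<open>idn C k x\<close> as its identity.
  For \<open>k\<close>-cells \<open>x\<close>, \<open>y\<close> and \<open>i < k\<close>, the cell \<open>cmp C i k y x\<close> is the composite of first \<open>x\<close>
  and then \<open>y\<close> along \<open>i\<close>-cells.  The sets \<open>cells C k\<close> need not be disjoint: the
  dimension of a cell is always passed as an argument.
\<close>

record 'a ocat =
  cells :: "nat \<Rightarrow> 'a set"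
  src :: "nat \<Rightarrow> 'a \<Rightarrow> 'a"
  tgt :: "nat \<Rightarrow> 'a \<Rightarrow> 'a"
  idn :: "nat \<Rightarrow> 'a \<Rightarrow> 'a"
  cmp :: "nat \<Rightarrow> nat \<Rightarrow> 'a \<Rightarrow> 'a \<Rightarrow> 'a"

text \<open>For \<open>i \<le> k\<close>: the \<open>i\<close>-source and the \<open>i\<close>-target of a \<open>k\<close>-cell, and the \<open>k\<close>-dimensional
  iterated identity of an \<open>i\<close>-cell.\<close>

primrec isrc :: "'a ocat \<Rightarrow> nat \<Rightarrow> nat \<Rightarrow> 'a \<Rightarrow> 'a" where
  "isrc C i 0 x = x"
| "isrc C i (Suc k) x = (if i \<le> k then isrc C i k (src C k x) else x)"

primrec itgt :: "'a ocat \<Rightarrow> nat \<Rightarrow> nat \<Rightarrow> 'a \<Rightarrow> 'a" where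
  "itgt C i 0 x = x"
| "itgt C i (Suc k) x = (if i \<le> k then itgt C i k (tgt C k x) else x)"

primrec iidn :: "'a ocat \<Rightarrow> nat \<Rightarrow> nat \<Rightarrow> 'a \<Rightarrow> 'a" where
  "iidn C i 0 x = x"
| "iidn C i (Suc k) x = (if i \<le> k then idn C k (iidn C i k x) else x)"

definition composable :: "'a ocat \<Rightarrow> nat \<Rightarrow> nat \<Rightarrow> 'a \<Rightarrow> 'a \<Rightarrow> bool" where
  "composable C i k y x \<longleftrightarrow>
     i < k \<and> x \<in> cells C k \<and> y \<in> cells C k \<and> itgt C i k x = isrc C i k y"

locale strict_omega_category =
  fixes C :: "'a ocat"
  assumes src_cell: "x \<in> cells C (Suc k) \<Longrightarrow> src C k x \<in> cells C k"
    and tgt_cell: "x \<in> cells C (Suc k) \<Longrightarrow> tgt C k x \<in> cells C k"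
    and src_src: "x \<in> cells C (Suc (Suc k)) \<Longrightarrow> src C k (src C (Suc k) x) = src C k (tgt C (Suc k) x)"
    and tgt_tgt: "x \<in> cells C (Suc (Suc k)) \<Longrightarrow> tgt C k (src C (Suc k) x) = tgt C k (tgt C (Suc k) x)"
    and idn_cell: "x \<in> cells C k \<Longrightarrow> idn C k x \<in> cells C (Suc k)"
    and src_idn: "x \<in> cells C k \<Longrightarrow> src C k (idn C k x) = x"
    and tgt_idn: "x \<in> cells C k \<Longrightarrow> tgt C k (idn C k x) = x"
    and cmp_cell: "composable C i k y x \<Longrightarrow> cmp C i k y x \<in> cells C k"
    and src_cmp_top: "composable C k (Suc k) y x \<Longrightarrow> src C k (cmp C k (Suc k) y x) = src C k x"
    and tgt_cmp_top: "composable C k (Suc k) y x \<Longrightarrow> tgt C k (cmp C k (Suc k) y x) = tgt C k y"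
    and src_cmp: "\<lbrakk>composable C i (Suc k) y x; i < k\<rbrakk> \<Longrightarrow>
      src C k (cmp C i (Suc k) y x) = cmp C i k (src C k y) (src C k x)"
    and tgt_cmp: "\<lbrakk>composable C i (Suc k) y x; i < k\<rbrakk> \<Longrightarrow>
      tgt C k (cmp C i (Suc k) y x) = cmp C i k (tgt C k y) (tgt C k x)"
    and cmp_assoc: "\<lbrakk>composable C i k y x; composable C i k z y\<rbrakk> \<Longrightarrow>
      cmp C i k (cmp C i k z y) x = cmp C i k z (cmp C i k y x)"
    and cmp_unit_src: "\<lbrakk>x \<in> cells C k; i < k\<rbrakk> \<Longrightarrow> cmp C i k x (iidn C i k (isrc C i k x)) = x"
    and cmp_unit_tgt: "\<lbrakk>x \<in> cells C k; i < k\<rbrakk> \<Longrightarrow> cmp C i k (iidn C i k (itgt C i k x)) x = x"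
    and interchange:
      "\<lbrakk>i < j; composable C j k x' x; composable C j k y' y;
        composable C i k y x; composable C i k y' x'\<rbrakk> \<Longrightarrow>
       cmp C i k (cmp C j k y' y) (cmp C j k x' x) = cmp C j k (cmp C i k y' x') (cmp C i k y x)"
    and idn_cmp: "composable C i k y x \<Longrightarrow>
      idn C k (cmp C i k y x) = cmp C i (Suc k) (idn C k y) (idn C k x)"

definition trivial_cell :: "'a ocat \<Rightarrow> nat \<Rightarrow> 'a \<Rightarrow> bool" where
  "trivial_cell C k x \<longleftrightarrow> (\<exists>y \<in> cells C k. x = idn C k y)"

locale strict_3_category = strict_omega_category +
  assumes trivial_above_3: "\<lbrakk>3 \<le> k; x \<in> cells C (Suc k)\<rbrakk> \<Longrightarrow> trivial_cell C k x"

definition omega_functor :: "'a ocat \<Rightarrow> 'b ocat \<Rightarrow> (nat \<Rightarrow> 'a \<Rightarrow> 'b) \<Rightarrow> bool" where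
  "omega_functor C D \<phi> \<longleftrightarrow>
     (\<forall>k. \<forall>x \<in> cells C k. \<phi> k x \<in> cells D k) \<and>
     (\<forall>k. \<forall>x \<in> cells C (Suc k). \<phi> k (src C k x) = src D k (\<phi> (Suc k) x)) \<and>
     (\<forall>k. \<forall>x \<in> cells C (Suc k). \<phi> k (tgt C k x) = tgt D k (\<phi> (Suc k) x)) \<and>
     (\<forall>k. \<forall>x \<in> cells C k. \<phi> (Suc k) (idn C k x) = idn D k (\<phi> k x)) \<and>
     (\<forall>i k x y. composable C i k y x \<longrightarrow> \<phi> k (cmp C i k y x) = cmp D i k (\<phi> k y) (\<phi> k x))"

text \<open>Functors are made extensional, so that equal functors are equal as functions.\<close>

definition omega_hom :: "'a ocat \<Rightarrow> 'b ocat \<Rightarrow> (nat \<Rightarrow> 'a \<Rightarrow> 'b) set" where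
  "omega_hom C D = {\<phi>. omega_functor C D \<phi> \<and> (\<forall>k. \<phi> k \<in> extensional (cells C k))}"

section \<open>Orientals\<close>

text \<open>The tuple \<open>(i\<^sub>0, \<dots>, i\<^sub>p)\<close> is the list of length \<open>Suc p\<close> with these entries.\<close>

type_synonym chain = "nat list \<Rightarrow>\<^sub>0 int"

definition tuples :: "nat \<Rightarrow> nat \<Rightarrow> nat list set" where
  "tuples n p = {\<sigma>. length \<sigma> = Suc p \<and> sorted_wrt (<) \<sigma> \<and> set \<sigma> \<subseteq> {..n}}"

inductive_set pos_chains :: "nat \<Rightarrow> nat \<Rightarrow> chain set" for n p where
  zero: "0 \<in> pos_chains n p"
| basis: "\<sigma> \<in> tuples n p \<Longrightarrow> frag_of \<sigma> \<in> pos_chains n p"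
| plus: "a \<in> pos_chains n p \<Longrightarrow> b \<in> pos_chains n p \<Longrightarrow> a + b \<in> pos_chains n p"

definition bdry :: "chain \<Rightarrow> chain" where
  "bdry = frag_extend (\<lambda>\<sigma>. \<Sum>k<length \<sigma>. frag_cmul ((-1) ^ k) (frag_of (take k \<sigma> @ drop (Suc k) \<sigma>)))"

definition augm :: "chain \<Rightarrow> int" where
  "augm c = (\<Sum>\<sigma> \<in> Poly_Mapping.keys c. Poly_Mapping.lookup c \<sigma>)"

definition pos_part :: "chain \<Rightarrow> chain" where
  "pos_part = Poly_Mapping.map (\<lambda>a. max a 0)"

definition neg_part :: "chain \<Rightarrow> chain" where
  "neg_part = Poly_Mapping.map (\<lambda>a. max (- a) 0)"

text \<open>
  A family \<open>(x\<^sup>\<epsilon>\<^sub>p)\<close> with \<open>0 \<le> p \<le> k\<close> is the function \<open>x\<close> with value \<open>x p \<epsilon>\<close> there, where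
  \<open>False\<close> stands for \<open>0\<close> and \<open>True\<close> for \<open>1\<close>, extended by zero to \<open>p > k\<close>.  With this
  encoding, adding a zero column does not change the function.
\<close>

type_synonym table = "nat \<Rightarrow> bool \<Rightarrow> chain"

definition oriental_cells :: "nat \<Rightarrow> nat \<Rightarrow> table set" where
  "oriental_cells n k = {x.
     (\<forall>p\<le>k. \<forall>\<epsilon>. x p \<epsilon> \<in> pos_chains n p) \<and>
     (\<forall>p>k. \<forall>\<epsilon>. x p \<epsilon> = 0) \<and>
     (\<forall>p<k. \<forall>\<epsilon>. bdry (x (Suc p) \<epsilon>) = x p True - x p False) \<and>
     (\<forall>\<epsilon>. augm (x 0 \<epsilon>) = 1) \<and>
     x k False = x k True}"

definition oriental :: "nat \<Rightarrow> table ocat" where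
  "oriental n = \<lparr>
     cells = oriental_cells n,
     src = (\<lambda>k x p \<epsilon>. if p < k then x p \<epsilon> else if p = k then x k False else 0),
     tgt = (\<lambda>k x p \<epsilon>. if p < k then x p \<epsilon> else if p = k then x k True else 0),
     idn = (\<lambda>k x. x),
     cmp = (\<lambda>j k x y p \<epsilon>. if p \<le> j then (if \<epsilon> then x p True else y p False) else x p \<epsilon> + y p \<epsilon>)\<rparr>"

text \<open>The entries of an atom are obtained from the top one by iterating \<open>(d -)\<^sub>-\<close> and \<open>(d -)\<^sub>+\<close> respectively.\<close>

definition atom :: "nat list \<Rightarrow> table" where
  "atom \<sigma> = (\<lambda>p \<epsilon>. if p < length \<sigma>
     then ((\<lambda>c. if \<epsilon> then pos_part (bdry c) else neg_part (bdry c)) ^^ (length \<sigma> - Suc p)) (frag_of \<sigma>)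
     else 0)"

text \<open>The cosimplicial structure: a monotone map acts on tuples entrywise, and a tuple whose
  image has a repeated entry is sent to zero.\<close>

definition chain_map :: "(nat \<Rightarrow> nat) \<Rightarrow> chain \<Rightarrow> chain" where
  "chain_map \<theta> = frag_extend (\<lambda>\<sigma>. if sorted_wrt (<) (map \<theta> \<sigma>) then frag_of (map \<theta> \<sigma>) else 0)"

definition oriental_map :: "(nat \<Rightarrow> nat) \<Rightarrow> table \<Rightarrow> table" where
  "oriental_map \<theta> x = (\<lambda>p \<epsilon>. chain_map \<theta> (x p \<epsilon>))"

section \<open>Simplicial sets and the Street nerve\<close>

text \<open>\<open>pull X m n \<theta>\<close> is the map from \<open>n\<close>-simplices to \<open>m\<close>-simplices of \<open>X\<close> induced by
  \<open>\<theta> : [m] \<rightarrow> [n]\<close>.\<close>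

record 'x sset =
  simps :: "nat \<Rightarrow> 'x set"
  pull :: "nat \<Rightarrow> nat \<Rightarrow> (nat \<Rightarrow> nat) \<Rightarrow> 'x \<Rightarrow> 'x"

definition simplex_map :: "nat \<Rightarrow> nat \<Rightarrow> (nat \<Rightarrow> nat) \<Rightarrow> bool" where
  "simplex_map m n \<theta> \<longleftrightarrow> mono_on {..m} \<theta> \<and> \<theta> ` {..m} \<subseteq> {..n}"

definition sset_morphism :: "'x sset \<Rightarrow> 'y sset \<Rightarrow> (nat \<Rightarrow> 'x \<Rightarrow> 'y) \<Rightarrow> bool" where
  "sset_morphism X Y F \<longleftrightarrow>
     (\<forall>n. \<forall>x \<in> simps X n. F n x \<in> simps Y n) \<and>
     (\<forall>m n \<theta>. simplex_map m n \<theta> \<longrightarrow>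
        (\<forall>x \<in> simps X n. F m (pull X m n \<theta> x) = pull Y m n \<theta> (F n x)))"

definition street_nerve :: "'a ocat \<Rightarrow> (nat \<Rightarrow> table \<Rightarrow> 'a) sset" where
  "street_nerve A = \<lparr>
     simps = (\<lambda>n. omega_hom (oriental n) A),
     pull = (\<lambda>m n \<theta> x k. restrict (\<lambda>c. x k (oriental_map \<theta> c)) (cells (oriental m) k))\<rparr>"

section \<open>Simplicial oplax 3-morphisms\<close>

definition edge :: "(nat \<Rightarrow> table \<Rightarrow> 'a) \<Rightarrow> nat \<Rightarrow> nat \<Rightarrow> 'a" where
  "edge x i j = x 1 (atom [i, j])"

definition triangle :: "(nat \<Rightarrow> table \<Rightarrow> 'a) \<Rightarrow> nat \<Rightarrow> nat \<Rightarrow> nat \<Rightarrow> 'a" where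
  "triangle x i j k = x 2 (atom [i, j, k])"

definition trivial_principal :: "'a ocat \<Rightarrow> (nat \<Rightarrow> table \<Rightarrow> 'a) \<Rightarrow> bool" where
  "trivial_principal A x \<longleftrightarrow> trivial_cell A 2 (x 3 (atom [0, 1, 2, 3]))"

definition arrow :: "'a ocat \<Rightarrow> nat \<Rightarrow> 'a \<Rightarrow> 'a \<Rightarrow> 'a \<Rightarrow> bool" where
  "arrow A k u v w \<longleftrightarrow> u \<in> cells A (Suc k) \<and> src A k u = v \<and> tgt A k u = w"

text \<open>
  A 3-simplex is determined by its edges, its triangles and its principal cell.  Each of the
  following predicates says that \<open>x\<close> is the 3-simplex with the prescribed ones.
\<close>

definition simplex_i :: "'a ocat \<Rightarrow> 'a \<Rightarrow> 'a \<Rightarrow> 'a \<Rightarrow> 'a \<Rightarrow> 'a \<Rightarrow> (nat \<Rightarrow> table \<Rightarrow> 'a) \<Rightarrow> bool" where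
  "simplex_i A a a' f g \<alpha> x \<longleftrightarrow>
     x \<in> simps (street_nerve A) 3 \<and>
     edge x 0 1 = idn A 0 a \<and> edge x 1 2 = g \<and> edge x 2 3 = idn A 0 a' \<and>
     edge x 0 2 = f \<and> edge x 1 3 = f \<and> edge x 0 3 = f \<and>
     triangle x 0 1 2 = \<alpha> \<and> triangle x 1 2 3 = \<alpha> \<and>
     triangle x 0 2 3 = idn A 1 f \<and> triangle x 0 1 3 = idn A 1 f \<and>
     trivial_principal A x"

definition simplex_ii :: "'a ocat \<Rightarrow> 'a \<Rightarrow> 'a \<Rightarrow> 'a \<Rightarrow> 'a \<Rightarrow> 'a \<Rightarrow> (nat \<Rightarrow> table \<Rightarrow> 'a) \<Rightarrow> bool" where
  "simplex_ii A a f g h \<alpha> x \<longleftrightarrow>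
     x \<in> simps (street_nerve A) 3 \<and>
     edge x 0 1 = idn A 0 a \<and> edge x 1 2 = g \<and> edge x 0 2 = g \<and>
     edge x 2 3 = h \<and> edge x 0 3 = f \<and> edge x 1 3 = cmp A 0 1 h g \<and>
     triangle x 0 1 2 = idn A 1 g \<and> triangle x 1 2 3 = idn A 1 (cmp A 0 1 h g) \<and>
     triangle x 0 2 3 = \<alpha> \<and> triangle x 0 1 3 = \<alpha> \<and>
     trivial_principal A x"

definition simplex_iii ::
    "'a ocat \<Rightarrow> 'a \<Rightarrow> 'a \<Rightarrow> 'a \<Rightarrow> 'a \<Rightarrow> 'a \<Rightarrow> 'a \<Rightarrow> 'a \<Rightarrow> (nat \<Rightarrow> table \<Rightarrow> 'a) \<Rightarrow> bool" where
  "simplex_iii A a'' f g h i \<alpha> \<beta> x \<longleftrightarrow>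
     x \<in> simps (street_nerve A) 3 \<and>
     edge x 0 1 = h \<and> edge x 1 2 = i \<and> edge x 1 3 = i \<and>
     edge x 2 3 = idn A 0 a'' \<and> edge x 0 3 = f \<and> edge x 0 2 = g \<and>
     triangle x 0 1 2 = \<beta> \<and> triangle x 0 2 3 = \<alpha> \<and>
     triangle x 0 1 3 = cmp A 1 2 \<beta> \<alpha> \<and> triangle x 1 2 3 = idn A 1 i \<and>
     trivial_principal A x"

definition simplicial_oplax_3_morphism ::
    "'a ocat \<Rightarrow> 'b ocat \<Rightarrow> (nat \<Rightarrow> (nat \<Rightarrow> table \<Rightarrow> 'a) \<Rightarrow> (nat \<Rightarrow> table \<Rightarrow> 'b)) \<Rightarrow> bool" where
  "simplicial_oplax_3_morphism A B F \<longleftrightarrow>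
     sset_morphism (street_nerve A) (street_nerve B) F \<and>
     (\<forall>a a' f g \<alpha> x.
        arrow A 0 f a a' \<and> arrow A 0 g a a' \<and> arrow A 1 \<alpha> f g \<and>
        simplex_i A a a' f g \<alpha> x
        \<longrightarrow> trivial_principal B (F 3 x)) \<and>
     (\<forall>a a' a'' f g h \<alpha> x.
        arrow A 0 g a a' \<and> arrow A 0 h a' a'' \<and> arrow A 1 \<alpha> f (cmp A 0 1 h g) \<and>
        simplex_ii A a f g h \<alpha> x
        \<longrightarrow> trivial_principal B (F 3 x)) \<and>
     (\<forall>a a' a'' f g h i \<alpha> \<beta> x.
        arrow A 0 h a a' \<and> arrow A 0 i a' a'' \<and>
        arrow A 1 \<alpha> f g \<and> arrow A 1 \<beta> g (cmp A 0 1 i h) \<and>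
        simplex_iii A a'' f g h i \<alpha> \<beta> x
        \<longrightarrow> trivial_principal B (F 3 x))"

end

theory Submission
  imports Defs
begin

text \<open>
  A 3-simplex with trivial principal cell is determined by its edges and triangles, because the
  third oriental is generated by its atoms. Hence a morphism of simplicial sets preserves
  coincidences between possibly degenerate 2-dimensional faces, and a simplicial oplax 3-morphism
  sends the simplices of (i) and (iii) to simplices of the same kind.

  The image of a simplex as in (ii) is only a simplex \<open>x\<close> with trivial principal cell whose face \<open>012\<close>
  is degenerate on \<open>02\<close>. Any such \<open>x\<close> is the face \<open>0123\<close> of a 4-simplex in which \<open>f\<^sub>3\<^sub>4\<close> and
  \<open>\<alpha>\<^sub>0\<^sub>3\<^sub>4\<close> are identities, the faces \<open>0124\<close> and \<open>0234\<close> are degenerate, \<open>0134\<close> is as in (i) and \<open>1234\<close> is as in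
  (iii). In a strict 3-category the principal cell of a 4-simplex is an identity; if the principal
  cells of the other four faces are trivial then so is that of \<open>0123\<close>, since it is whiskered only
  by \<open>f\<^sub>3\<^sub>4\<close> and \<open>\<alpha>\<^sub>0\<^sub>3\<^sub>4\<close>.
\<close>

section \<open>Chains\<close>

text \<open>A morphism \<open>F\<close> of nerves respects composites of 1-cells only up to a
  2-cell: in the image of a simplex as in (ii), the triangle 123 is a comparison from the image of
  \<open>hg\<close> to the composite of the images of \<open>h\<close> and \<open>g\<close>, and
  need not be an identity. So conditions naming composites are replaced by coincidences of faces,
  which every morphism respects.

  In the 4-simplex, vertex 4 repeats vertex 3, but the edge 14 is the edge 03 of \<open>x\<close>
  and not 13. As the edge 01 is an identity, the triangle 013 of \<open>x\<close> is a 2-cell from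
  03 to 13 and can also stand as triangle 134; this gives 0134 the shape of (i). Then 1234 has the
  shape of (iii) once 124 is the composite of 123 after 013, and this composite is the triangle 023
  of \<open>x\<close>, because the principal cell of \<open>x\<close> is trivial. Since 13 and 14
  differ in general, no map of vertices from [4] to [3] yields this simplex; it is a pullback along
  a chain map.\<close>

definition linear_ext :: "(nat list \<Rightarrow> int) \<Rightarrow> chain \<Rightarrow> int" where
  "linear_ext w c = (\<Sum>\<sigma> \<in> Poly_Mapping.keys c. Poly_Mapping.lookup c \<sigma> * w \<sigma>)"

lemma linear_ext_superset:
  assumes "finite S" "Poly_Mapping.keys c \<subseteq> S"
  shows "linear_ext w c = (\<Sum>\<sigma> \<in> S. Poly_Mapping.lookup c \<sigma> * w \<sigma>)"
  unfolding linear_ext_def using assms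
  by (intro sum.mono_neutral_left) (auto simp: in_keys_iff)

lemma linear_ext_0 [simp]: "linear_ext w 0 = 0"
  by (simp add: linear_ext_def)

lemma linear_ext_frag_of [simp]: "linear_ext w (frag_of \<sigma>) = w \<sigma>"
  by (simp add: linear_ext_def)

lemma linear_ext_add [simp]: "linear_ext w (c + d) = linear_ext w c + linear_ext w d"
proof -
  let ?S = "Poly_Mapping.keys c \<union> Poly_Mapping.keys d"
  have "linear_ext w (c + d) = (\<Sum>\<sigma>\<in>?S. Poly_Mapping.lookup (c + d) \<sigma> * w \<sigma>)"
    by (rule linear_ext_superset) (use keys_add[of c d] in auto)
  also have "\<dots> = (\<Sum>\<sigma>\<in>?S. Poly_Mapping.lookup c \<sigma> * w \<sigma>) + (\<Sum>\<sigma>\<in>?S. Poly_Mapping.lookup d \<sigma> * w \<sigma>)"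
    by (simp add: lookup_add algebra_simps sum.distrib)
  finally show ?thesis
    using linear_ext_superset[of ?S c w] linear_ext_superset[of ?S d w] by auto
qed

lemma linear_ext_diff [simp]: "linear_ext w (c - d) = linear_ext w c - linear_ext w d"
  using linear_ext_add[of w "c - d" d] by simp

lemma augm_eq_linear_ext: "augm = linear_ext (\<lambda>_. 1)"
  by (simp add: fun_eq_iff augm_def linear_ext_def)

lemma bdry_0 [simp]: "bdry 0 = 0"
  by (simp add: bdry_def)

lemma bdry_add [simp]: "bdry (c + d) = bdry c + bdry d"
  by (simp add: bdry_def frag_extend_add)

lemma bdry_diff [simp]: "bdry (c - d) = bdry c - bdry d"
  by (simp add: bdry_def frag_extend_diff)

lemma bdry_frag_of_2 [simp]: "bdry (frag_of [i, j]) = frag_of [j] - frag_of [i]"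
  by (simp add: bdry_def)

lemma bdry_frag_of_3 [simp]:
  "bdry (frag_of [i, j, k]) = frag_of [j, k] - frag_of [i, k] + frag_of [i, j]"
  by (simp add: bdry_def lessThan_Suc eval_nat_numeral algebra_simps)

lemma bdry_frag_of_4 [simp]:
  "bdry (frag_of [i, j, k, l]) = frag_of [j, k, l] - frag_of [i, k, l] + frag_of [i, j, l] - frag_of [i, j, k]"
  by (simp add: bdry_def lessThan_Suc eval_nat_numeral algebra_simps)

lemma bdry_frag_of_5 [simp]:
  "bdry (frag_of [i, j, k, l, m]) = frag_of [j, k, l, m] - frag_of [i, k, l, m] + frag_of [i, j, l, m]
     - frag_of [i, j, k, m] + frag_of [i, j, k, l]"
  by (simp add: bdry_def lessThan_Suc eval_nat_numeral algebra_simps)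

lemma lookup_frag_extend:
  "Poly_Mapping.lookup (frag_extend g c) \<rho> = linear_ext (\<lambda>\<sigma>. Poly_Mapping.lookup (g \<sigma>) \<rho>) c"
  by (simp add: frag_extend_def linear_ext_def lookup_sum)

lemma bdry_frag_of: "bdry (frag_of \<sigma>) =
    (\<Sum>k<length \<sigma>. frag_cmul ((-1) ^ k) (frag_of (take k \<sigma> @ drop (Suc k) \<sigma>)))"
  unfolding bdry_def by (rule frag_extend_of)

lemma bdry_eq_frag_extend: "bdry c = frag_extend (\<lambda>\<sigma>. bdry (frag_of \<sigma>)) c"
  by (simp only: bdry_frag_of) (simp only: bdry_def)

text \<open>Writes a coefficient of the boundary as a weighted sum over the tuples of
  \<open>c\<close>, so that a negative coefficient can be traced back to a single tuple by
  \<open>negative_coefficient\<close>.\<close>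

lemma lookup_bdry: "Poly_Mapping.lookup (bdry c) \<rho> = linear_ext (\<lambda>\<sigma>. Poly_Mapping.lookup (bdry (frag_of \<sigma>)) \<rho>) c"
  by (subst bdry_eq_frag_extend) (rule lookup_frag_extend)

lemma tuples_1: "\<sigma> \<in> tuples n 0 \<longleftrightarrow> (\<exists>i\<le>n. \<sigma> = [i])"
  by (auto simp: tuples_def length_Suc_conv)

lemma tuples_2: "\<sigma> \<in> tuples n 1 \<longleftrightarrow> (\<exists>i j. i < j \<and> j \<le> n \<and> \<sigma> = [i, j])"
  by (auto simp: tuples_def length_Suc_conv)

lemma tuples_3: "\<sigma> \<in> tuples n 2 \<longleftrightarrow> (\<exists>i j k. i < j \<and> j < k \<and> k \<le> n \<and> \<sigma> = [i, j, k])"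
  by (auto simp: tuples_def length_Suc_conv eval_nat_numeral)

lemma tuples_4: "\<sigma> \<in> tuples n 3 \<longleftrightarrow> (\<exists>i j k l. i < j \<and> j < k \<and> k < l \<and> l \<le> n \<and> \<sigma> = [i, j, k, l])"
  by (auto simp: tuples_def length_Suc_conv eval_nat_numeral)

lemma tuples_empty: "n < p \<Longrightarrow> tuples n p = {}"
proof -
  { fix \<sigma> assume "\<sigma> \<in> tuples n p"
    then have *: "length \<sigma> = Suc p" "distinct \<sigma>" "set \<sigma> \<subseteq> {..n}"
      by (auto simp: tuples_def strict_sorted_iff)
    then have "Suc p \<le> Suc n"
      using card_mono[of "{..n}" "set \<sigma>"] distinct_card[of \<sigma>] by simp
    then have "p \<le> n" by simp }
  then show "n < p \<Longrightarrow> tuples n p = {}" by force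
qed

section \<open>Positive chains by their coefficients\<close>

definition nonneg :: "chain \<Rightarrow> bool" where
  "nonneg c \<longleftrightarrow> (\<forall>\<sigma>. 0 \<le> Poly_Mapping.lookup c \<sigma>)"

lemma nonneg_linear_ext:
  assumes "nonneg c" "\<And>\<sigma>. \<sigma> \<in> Poly_Mapping.keys c \<Longrightarrow> 0 \<le> w \<sigma>"
  shows "0 \<le> linear_ext w c"
  using assms by (auto simp: linear_ext_def nonneg_def intro!: sum_nonneg)

lemma nonneg_linear_ext_mono:
  assumes "nonneg c" "\<And>\<sigma>. \<sigma> \<in> Poly_Mapping.keys c \<Longrightarrow> w \<sigma> \<le> w' \<sigma>"
  shows "linear_ext w c \<le> linear_ext w' c"
  using assms by (auto simp: linear_ext_def nonneg_def intro!: sum_mono mult_left_mono)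

lemma nonneg_keys: "nonneg c \<Longrightarrow> \<sigma> \<in> Poly_Mapping.keys c \<longleftrightarrow> 0 < Poly_Mapping.lookup c \<sigma>"
  by (auto simp: nonneg_def in_keys_iff order.strict_iff_order)

lemma nonneg_augm_pos: "nonneg c \<Longrightarrow> c \<noteq> 0 \<Longrightarrow> 0 < augm c"
  by (auto simp: augm_def nonneg_keys intro!: sum_pos)

lemma pos_chainsD: "c \<in> pos_chains n p \<Longrightarrow> nonneg c \<and> Poly_Mapping.keys c \<subseteq> tuples n p"
proof (induction rule: pos_chains.induct)
  case (plus a b)
  then show ?case
    using keys_add[of a b] by (auto simp: nonneg_def lookup_add)
qed (auto simp: nonneg_def)

lemma nonneg_diff:
  "nonneg c \<Longrightarrow> \<sigma> \<in> Poly_Mapping.keys c \<Longrightarrow> nonneg (c - frag_of \<sigma>)"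
  by (auto simp: nonneg_def lookup_minus in_keys_iff) (metis int_one_le_iff_zero_less order_less_le)

lemma keys_diff_frag_of:
  "\<sigma> \<in> Poly_Mapping.keys c \<Longrightarrow> Poly_Mapping.keys (c - frag_of \<sigma>) \<subseteq> Poly_Mapping.keys c"
  by (auto simp: in_keys_iff lookup_minus split: if_splits)

text \<open>Basis tuples are split off one at a time, which lowers the sum of the coefficients. This
  gives the generated submonoid its description by coordinates.\<close>

lemma pos_chainsI:
  assumes "nonneg c" "Poly_Mapping.keys c \<subseteq> tuples n p"
  shows "c \<in> pos_chains n p"
  using assms
proof (induction "nat (augm c)" arbitrary: c rule: less_induct)
  case less
  show ?case
  proof (cases "c = 0")
    case True
    then show ?thesis by (simp add: pos_chains.zero)
  next
    case False
    then obtain \<sigma> where \<sigma>: "\<sigma> \<in> Poly_Mapping.keys c"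
      by (metis ex_in_conv keys_eq_empty)
    have "nat (augm (c - frag_of \<sigma>)) < nat (augm c)"
      using nonneg_augm_pos[OF less.prems(1) False] by (simp add: augm_eq_linear_ext)
    then have "c - frag_of \<sigma> \<in> pos_chains n p"
      using less \<sigma> nonneg_diff keys_diff_frag_of by (meson order_trans)
    then have "c - frag_of \<sigma> + frag_of \<sigma> \<in> pos_chains n p"
      using \<sigma> less.prems(2) by (intro pos_chains.plus pos_chains.basis) auto
    then show ?thesis by simp
  qed
qed

lemma pos_chains_iff: "c \<in> pos_chains n p \<longleftrightarrow> nonneg c \<and> Poly_Mapping.keys c \<subseteq> tuples n p"
  using pos_chainsD pos_chainsI by blast

lemma pos_chains_diff:
  "c \<in> pos_chains n p \<Longrightarrow> \<sigma> \<in> Poly_Mapping.keys c \<Longrightarrow> c - frag_of \<sigma> \<in> pos_chains n p"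
  unfolding pos_chains_iff using nonneg_diff keys_diff_frag_of by (meson order_trans)

lemma pos_chains_eq_0: "n < p \<Longrightarrow> c \<in> pos_chains n p \<Longrightarrow> c = 0"
  by (simp add: pos_chains_iff tuples_empty)

lemma pos_chains_augm_0: "c \<in> pos_chains n p \<Longrightarrow> augm c = 0 \<Longrightarrow> c = 0"
  using nonneg_augm_pos pos_chains_iff by force

text \<open>Applied in degree 0, where cells have augmentation 1: their source and target there are
  single vertices.\<close>

lemma pos_chains_augm_1:
  assumes "c \<in> pos_chains n p" "augm c = 1"
  obtains \<sigma> where "\<sigma> \<in> tuples n p" "c = frag_of \<sigma>"
proof -
  obtain \<sigma> where \<sigma>: "\<sigma> \<in> Poly_Mapping.keys c"
    using assms(2) by (metis augm_eq_linear_ext ex_in_conv keys_eq_empty linear_ext_0 zero_neq_one)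
  have "augm (c - frag_of \<sigma>) = 0" using assms(2) by (simp add: augm_eq_linear_ext)
  then have "c = frag_of \<sigma>"
    using pos_chains_augm_0[OF pos_chains_diff[OF assms(1) \<sigma>]] by simp
  with \<sigma> assms(1) that show thesis by (auto simp: pos_chains_iff)
qed

lemma negative_coefficient:
  assumes "c \<in> pos_chains n p" "linear_ext w c < 0"
  obtains \<sigma> where "\<sigma> \<in> Poly_Mapping.keys c" "w \<sigma> < 0"
  using assms nonneg_linear_ext[of c w] by (force simp: pos_chains_iff)

section \<open>Cells of orientals\<close>

text \<open>
  The table of a cell of dimension at most 3 in an oriental: \<open>s\<^sub>p\<close> and \<open>t\<^sub>p\<close> are its entries
  \<open>x\<^sup>0\<^sub>p\<close> and \<open>x\<^sup>1\<^sub>p\<close>, and \<open>c\<close> is both \<open>x\<^sup>0\<^sub>3\<close> and \<open>x\<^sup>1\<^sub>3\<close>.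
\<close>

definition tab :: "chain \<Rightarrow> chain \<Rightarrow> chain \<Rightarrow> chain \<Rightarrow> chain \<Rightarrow> chain \<Rightarrow> chain \<Rightarrow> table" where
  "tab s0 t0 s1 t1 s2 t2 c = (\<lambda>p \<epsilon>.
     if p = 0 then (if \<epsilon> then t0 else s0) else if p = 1 then (if \<epsilon> then t1 else s1)
     else if p = 2 then (if \<epsilon> then t2 else s2) else if p = 3 then c else 0)"

abbreviation tab0 :: "chain \<Rightarrow> table" where
  "tab0 v \<equiv> tab v v 0 0 0 0 0"

abbreviation tab1 :: "chain \<Rightarrow> chain \<Rightarrow> chain \<Rightarrow> table" where
  "tab1 s0 t0 c \<equiv> tab s0 t0 c c 0 0 0"

abbreviation tab2 :: "chain \<Rightarrow> chain \<Rightarrow> chain \<Rightarrow> chain \<Rightarrow> chain \<Rightarrow> table" where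
  "tab2 s0 t0 s1 t1 c \<equiv> tab s0 t0 s1 t1 c c 0"

lemma less_3_nat: "(p::nat) < 3 \<longleftrightarrow> p = 0 \<or> p = 1 \<or> p = 2" by auto
lemma le_3_nat: "(p::nat) \<le> 3 \<longleftrightarrow> p = 0 \<or> p = 1 \<or> p = 2 \<or> p = 3" by auto

lemma zero_pos_chains [simp]: "0 \<in> pos_chains n p"
  by (rule pos_chains.zero)

lemma oriental_simps:
  "cells (oriental n) = oriental_cells n"
  "src (oriental n) k x = (\<lambda>p \<epsilon>. if p < k then x p \<epsilon> else if p = k then x k False else 0)"
  "tgt (oriental n) k x = (\<lambda>p \<epsilon>. if p < k then x p \<epsilon> else if p = k then x k True else 0)"
  "idn (oriental n) k x = x"
  "cmp (oriental n) j k x y =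
     (\<lambda>p \<epsilon>. if p \<le> j then (if \<epsilon> then x p True else y p False) else x p \<epsilon> + y p \<epsilon>)"
  by (simp_all add: oriental_def)

lemma tab_in_cells_3:
  "tab s0 t0 s1 t1 s2 t2 c \<in> cells (oriental n) 3 \<longleftrightarrow>
     s0 \<in> pos_chains n 0 \<and> t0 \<in> pos_chains n 0 \<and> s1 \<in> pos_chains n 1 \<and> t1 \<in> pos_chains n 1 \<and>
     s2 \<in> pos_chains n 2 \<and> t2 \<in> pos_chains n 2 \<and> c \<in> pos_chains n 3 \<and>
     augm s0 = 1 \<and> augm t0 = 1 \<and> bdry s1 = t0 - s0 \<and> bdry t1 = t0 - s0 \<and>
     bdry s2 = t1 - s1 \<and> bdry t2 = t1 - s1 \<and> bdry c = t2 - s2"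
  by (auto simp: oriental_simps oriental_cells_def tab_def le_3_nat less_3_nat all_bool_eq)

lemma oriental_cellsD:
  assumes "x \<in> cells (oriental n) k"
  shows "p \<le> k \<Longrightarrow> x p \<epsilon> \<in> pos_chains n p" "k < p \<Longrightarrow> x p \<epsilon> = 0"
    "p < k \<Longrightarrow> bdry (x (Suc p) \<epsilon>) = x p True - x p False"
    "augm (x 0 \<epsilon>) = 1" "x k False = x k True"
  using assms by (simp_all add: oriental_simps oriental_cells_def)

lemma oriental_cellsI:
  assumes "\<And>p \<epsilon>. p \<le> k \<Longrightarrow> x p \<epsilon> \<in> pos_chains n p" "\<And>p \<epsilon>. k < p \<Longrightarrow> x p \<epsilon> = 0"
    "\<And>p \<epsilon>. p < k \<Longrightarrow> bdry (x (Suc p) \<epsilon>) = x p True - x p False"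
    "\<And>\<epsilon>. augm (x 0 \<epsilon>) = 1" "x k False = x k True"
  shows "x \<in> cells (oriental n) k"
  using assms by (simp add: oriental_simps oriental_cells_def)

lemma cell_eq_tab:
  assumes "x \<in> cells (oriental n) k" "k \<le> 3"
  shows "x = tab (x 0 False) (x 0 True) (x 1 False) (x 1 True) (x 2 False) (x 2 True) (x 3 False)"
proof (intro ext)
  have *: "x 3 True = x 3 False"
    using assms oriental_cellsD(2,5)[OF assms(1)] by (cases "k = 3") auto
  fix p :: nat and \<epsilon>
  consider "p = 0" | "p = 1" | "p = 2" | "p = 3" | "p > 3" by linarith
  then show "x p \<epsilon> = tab (x 0 False) (x 0 True) (x 1 False) (x 1 True) (x 2 False) (x 2 True) (x 3 False) p \<epsilon>"
    using oriental_cellsD(2)[OF assms(1), of p \<epsilon>] assms(2) *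
    by cases (cases \<epsilon>; simp add: tab_def)+
qed

text \<open>The boundary of a zero top entry equates the two entries below it. As identities do not
  change tables, the cell is then the identity of the same table one dimension lower.\<close>

lemma cells_pred:
  assumes "x \<in> cells (oriental n) (Suc k)" "x (Suc k) False = 0"
  shows "x \<in> cells (oriental n) k"
proof (rule oriental_cellsI)
  note x = oriental_cellsD[OF assms(1)]
  show "x p \<epsilon> = 0" if "k < p" for p \<epsilon>
    using that x(2)[of p \<epsilon>] x(5) assms(2) by (cases "p = Suc k"; cases \<epsilon>) auto
  show "x k False = x k True"
    using x(3)[of k False] assms(2) by simp
qed (use oriental_cellsD[OF assms(1)] in auto)

lemma cells_Suc:
  assumes "x \<in> cells (oriental n) k"
  shows "x \<in> cells (oriental n) (Suc k)"
proof (rule oriental_cellsI)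
  note x = oriental_cellsD[OF assms(1)]
  show "x p \<epsilon> \<in> pos_chains n p" if "p \<le> Suc k" for p \<epsilon>
    using that x(1,2)[of p \<epsilon>] by (cases "p = Suc k") auto
  show "bdry (x (Suc p) \<epsilon>) = x p True - x p False" if "p < Suc k" for p \<epsilon>
    using that x(2)[of "Suc p" \<epsilon>] x(3)[of p \<epsilon>] x(5) by (cases "p = k") auto
qed (use oriental_cellsD[OF assms(1)] in auto)

lemma cells_mono: "k \<le> l \<Longrightarrow> x \<in> cells (oriental n) k \<Longrightarrow> x \<in> cells (oriental n) l"
  by (induction rule: dec_induct) (auto intro: cells_Suc)

text \<open>Tables of lower cells are also tables of 3-cells, so that one membership test,
  \<open>tab_in_cells_3\<close>, serves in all dimensions up to 3.\<close>

lemma tab_in_cells_2: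
  "tab2 s0 t0 s1 t1 c \<in> cells (oriental n) 2 \<longleftrightarrow> tab2 s0 t0 s1 t1 c \<in> cells (oriental n) 3"
  using cells_pred[of "tab2 s0 t0 s1 t1 c" n 2] cells_mono[of 2 3]
  by (auto simp: tab_def eval_nat_numeral)

lemma tab_in_cells_1:
  "tab1 s0 t0 c \<in> cells (oriental n) 1 \<longleftrightarrow> tab1 s0 t0 c \<in> cells (oriental n) 3"
  using cells_pred[of "tab1 s0 t0 c" n 1] cells_pred[of "tab1 s0 t0 c" n 2] cells_mono[of 1 3]
  by (auto simp: tab_def eval_nat_numeral)

lemma tab_in_cells_0:
  "tab0 v \<in> cells (oriental n) 0 \<longleftrightarrow> tab0 v \<in> cells (oriental n) 3"
  using cells_pred[of "tab0 v" n 0] cells_pred[of "tab0 v" n 1] cells_pred[of "tab0 v" n 2]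
    cells_mono[of 0 3]
  by (auto simp: tab_def eval_nat_numeral)

lemmas tab_in_cells = tab_in_cells_0 tab_in_cells_1[simplified] tab_in_cells_2 tab_in_cells_3[simplified]

lemma src_tab:
  "src (oriental n) 0 (tab s0 t0 s1 t1 s2 t2 c) = tab0 s0"
  "src (oriental n) 1 (tab s0 t0 s1 t1 s2 t2 c) = tab1 s0 t0 s1"
  "src (oriental n) (Suc 0) (tab s0 t0 s1 t1 s2 t2 c) = tab1 s0 t0 s1"
  "src (oriental n) 2 (tab s0 t0 s1 t1 s2 t2 c) = tab2 s0 t0 s1 t1 s2"
  by (auto simp: oriental_simps tab_def fun_eq_iff)

lemma tgt_tab:
  "tgt (oriental n) 0 (tab s0 t0 s1 t1 s2 t2 c) = tab0 t0"
  "tgt (oriental n) 1 (tab s0 t0 s1 t1 s2 t2 c) = tab1 s0 t0 t1"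
  "tgt (oriental n) (Suc 0) (tab s0 t0 s1 t1 s2 t2 c) = tab1 s0 t0 t1"
  "tgt (oriental n) 2 (tab s0 t0 s1 t1 s2 t2 c) = tab2 s0 t0 s1 t1 t2"
  by (auto simp: oriental_simps tab_def fun_eq_iff)

lemma cmp_tab:
  "cmp (oriental n) 0 k (tab s0' t0' s1' t1' s2' t2' c') (tab s0 t0 s1 t1 s2 t2 c)
     = tab s0 t0' (s1' + s1) (t1' + t1) (s2' + s2) (t2' + t2) (c' + c)"
  "cmp (oriental n) 1 k (tab s0' t0' s1' t1' s2' t2' c') (tab s0 t0 s1 t1 s2 t2 c)
     = tab s0 t0' s1 t1' (s2' + s2) (t2' + t2) (c' + c)"
  "cmp (oriental n) (Suc 0) k (tab s0' t0' s1' t1' s2' t2' c') (tab s0 t0 s1 t1 s2 t2 c)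
     = tab s0 t0' s1 t1' (s2' + s2) (t2' + t2) (c' + c)"
  "cmp (oriental n) 2 k (tab s0' t0' s1' t1' s2' t2' c') (tab s0 t0 s1 t1 s2 t2 c)
     = tab s0 t0' s1 t1' s2 t2' (c' + c)"
  by (auto simp: oriental_simps tab_def fun_eq_iff)

lemma isrc_numeral:
  "isrc C 0 (Suc 0) x = src C 0 x"
  "isrc C 0 2 x = src C 0 (src C 1 x)"
  "isrc C 0 3 x = src C 0 (src C 1 (src C 2 x))"
  "isrc C (Suc 0) 2 x = src C 1 x"
  "isrc C (Suc 0) 3 x = src C 1 (src C 2 x)"
  "isrc C 2 3 x = src C 2 x"
  by (simp_all add: numeral_3_eq_3 numeral_2_eq_2)

lemma itgt_numeral:
  "itgt C 0 (Suc 0) x = tgt C 0 x"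
  "itgt C 0 2 x = tgt C 0 (tgt C 1 x)"
  "itgt C 0 3 x = tgt C 0 (tgt C 1 (tgt C 2 x))"
  "itgt C (Suc 0) 2 x = tgt C 1 x"
  "itgt C (Suc 0) 3 x = tgt C 1 (tgt C 2 x)"
  "itgt C 2 3 x = tgt C 2 x"
  by (simp_all add: numeral_3_eq_3 numeral_2_eq_2)

lemma tab_eq_iff:
  "tab s0 t0 s1 t1 s2 t2 c = tab s0' t0' s1' t1' s2' t2' c' \<longleftrightarrow>
     s0 = s0' \<and> t0 = t0' \<and> s1 = s1' \<and> t1 = t1' \<and> s2 = s2' \<and> t2 = t2' \<and> c = c'"
proof
  assume *: "tab s0 t0 s1 t1 s2 t2 c = tab s0' t0' s1' t1' s2' t2' c'"
  have "tab s0 t0 s1 t1 s2 t2 c p \<epsilon> = tab s0' t0' s1' t1' s2' t2' c' p \<epsilon>" for p \<epsilon>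
    by (simp add: *)
  from this[of 0 False] this[of 0 True] this[of 1 False] this[of 1 True]
    this[of 2 False] this[of 2 True] this[of 3 False]
  show "s0 = s0' \<and> t0 = t0' \<and> s1 = s1' \<and> t1 = t1' \<and> s2 = s2' \<and> t2 = t2' \<and> c = c'"
    by (simp add: tab_def)
qed simp

subsection \<open>Atoms\<close>

lemma pos_neg_part_diff:
  assumes "nonneg a" "nonneg b" "Poly_Mapping.keys a \<inter> Poly_Mapping.keys b = {}"
  shows "pos_part (a - b) = a" "neg_part (a - b) = b"
proof -
  have "Poly_Mapping.lookup a \<sigma> = 0 \<or> Poly_Mapping.lookup b \<sigma> = 0" for \<sigma>
    using assms(3) by (auto simp: in_keys_iff)
  moreover have "0 \<le> Poly_Mapping.lookup a \<sigma>" "0 \<le> Poly_Mapping.lookup b \<sigma>" for \<sigma>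
    using assms(1,2) by (auto simp: nonneg_def)
  ultimately show "pos_part (a - b) = a" "neg_part (a - b) = b"
    by (auto intro!: poly_mapping_eqI simp: pos_part_def neg_part_def map.rep_eq lookup_minus when_def)
      (smt (verit))+
qed

lemma nonneg_frag_of: "nonneg (frag_of \<sigma>)"
  by (simp add: nonneg_def)

lemma nonneg_add: "nonneg a \<Longrightarrow> nonneg b \<Longrightarrow> nonneg (a + b)"
  by (simp add: nonneg_def lookup_add)

lemma keys_nonneg_add:
  "nonneg a \<Longrightarrow> nonneg b \<Longrightarrow> Poly_Mapping.keys (a + b) = Poly_Mapping.keys a \<union> Poly_Mapping.keys b"
  by (auto simp: nonneg_def in_keys_iff lookup_add)
    (metis add_nonneg_eq_0_iff)+

lemmas nonneg_intros = nonneg_frag_of nonneg_add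

text \<open>With disjoint supports nothing cancels, so the faces of an atom can be guessed and then
  verified instead of being computed.\<close>

lemma pos_part_bdryI:
  "bdry c = a - b \<Longrightarrow> nonneg a \<Longrightarrow> nonneg b \<Longrightarrow>
   Poly_Mapping.keys a \<inter> Poly_Mapping.keys b = {} \<Longrightarrow> pos_part (bdry c) = a"
  using pos_neg_part_diff by simp

lemma neg_part_bdryI:
  "bdry c = a - b \<Longrightarrow> nonneg a \<Longrightarrow> nonneg b \<Longrightarrow>
   Poly_Mapping.keys a \<inter> Poly_Mapping.keys b = {} \<Longrightarrow> neg_part (bdry c) = b"
  using pos_neg_part_diff by simp

lemma atom_1: "atom [i] = tab0 (frag_of [i])"
  by (auto simp: atom_def tab_def fun_eq_iff)

lemma atom_2:
  assumes "i \<noteq> j"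
  shows "atom [i, j] = tab1 (frag_of [i]) (frag_of [j]) (frag_of [i, j])"
proof -
  have "pos_part (bdry (frag_of [i, j])) = frag_of [j]"
    by (rule pos_part_bdryI[where b = "frag_of [i]"]) (use assms in \<open>auto simp: nonneg_intros\<close>)
  moreover have "neg_part (bdry (frag_of [i, j])) = frag_of [i]"
    by (rule neg_part_bdryI[where a = "frag_of [j]"]) (use assms in \<open>auto simp: nonneg_intros\<close>)
  ultimately show ?thesis
    by (auto simp: atom_def tab_def fun_eq_iff simp del: bdry_frag_of_2)
qed

lemma atom_3:
  assumes "i < j" "j < k"
  shows "atom [i, j, k] = tab2 (frag_of [i]) (frag_of [k])
    (frag_of [i, k]) (frag_of [i, j] + frag_of [j, k]) (frag_of [i, j, k])"
proof -
  have "pos_part (bdry (frag_of [i, j, k])) = frag_of [i, j] + frag_of [j, k]"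
    by (rule pos_part_bdryI[where b = "frag_of [i, k]"])
      (use assms in \<open>auto simp: nonneg_intros keys_nonneg_add\<close>)
  moreover have "neg_part (bdry (frag_of [i, j, k])) = frag_of [i, k]"
    by (rule neg_part_bdryI[where a = "frag_of [i, j] + frag_of [j, k]"])
      (use assms in \<open>auto simp: nonneg_intros keys_nonneg_add\<close>)
  moreover have "pos_part (bdry (frag_of [i, j] + frag_of [j, k])) = frag_of [k]"
    by (rule pos_part_bdryI[where b = "frag_of [i]"]) (use assms in \<open>auto simp: nonneg_intros\<close>)
  moreover have "neg_part (bdry (frag_of [i, k])) = frag_of [i]"
    by (rule neg_part_bdryI[where a = "frag_of [k]"]) (use assms in \<open>auto simp: nonneg_intros\<close>)
  ultimately show ?thesis
    by (auto simp: atom_def tab_def fun_eq_iff less_Suc_eq numeral_2_eq_2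
        simp del: bdry_frag_of_2 bdry_frag_of_3 bdry_add)
qed

text \<open>The diagonal \<open>[i, k]\<close> is shared by the two source triangles and
  \<open>[j, l]\<close> by the two target triangles; it cancels in the boundary, which leaves the
  spine minus the long edge.\<close>

lemma atom_4:
  assumes "i < j" "j < k" "k < l"
  shows "atom [i, j, k, l] = tab (frag_of [i]) (frag_of [l])
    (frag_of [i, l]) (frag_of [i, j] + frag_of [j, k] + frag_of [k, l])
    (frag_of [i, j, k] + frag_of [i, k, l]) (frag_of [j, k, l] + frag_of [i, j, l])
    (frag_of [i, j, k, l])"
proof -
  have "pos_part (bdry (frag_of [i, j, k, l])) = frag_of [j, k, l] + frag_of [i, j, l]"
    by (rule pos_part_bdryI[where b = "frag_of [i, j, k] + frag_of [i, k, l]"])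
      (use assms in \<open>auto simp: nonneg_intros keys_nonneg_add\<close>)
  moreover have "neg_part (bdry (frag_of [i, j, k, l])) = frag_of [i, j, k] + frag_of [i, k, l]"
    by (rule neg_part_bdryI[where a = "frag_of [j, k, l] + frag_of [i, j, l]"])
      (use assms in \<open>auto simp: nonneg_intros keys_nonneg_add\<close>)
  moreover have "pos_part (bdry (frag_of [j, k, l] + frag_of [i, j, l]))
      = frag_of [i, j] + frag_of [j, k] + frag_of [k, l]"
    by (rule pos_part_bdryI[where b = "frag_of [i, l]"])
      (use assms in \<open>auto simp: nonneg_intros keys_nonneg_add\<close>)
  moreover have "neg_part (bdry (frag_of [i, j, k] + frag_of [i, k, l])) = frag_of [i, l]"
    by (rule neg_part_bdryI[where a = "frag_of [i, j] + frag_of [j, k] + frag_of [k, l]"])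
      (use assms in \<open>auto simp: nonneg_intros keys_nonneg_add\<close>)
  moreover have "pos_part (bdry (frag_of [i, j] + frag_of [j, k] + frag_of [k, l])) = frag_of [l]"
    by (rule pos_part_bdryI[where b = "frag_of [i]"]) (use assms in \<open>auto simp: nonneg_intros\<close>)
  moreover have "neg_part (bdry (frag_of [i, l])) = frag_of [i]"
    by (rule neg_part_bdryI[where a = "frag_of [l]"]) (use assms in \<open>auto simp: nonneg_intros\<close>)
  ultimately show ?thesis
    by (auto simp: atom_def tab_def fun_eq_iff less_Suc_eq numeral_2_eq_2 numeral_3_eq_3
        simp del: bdry_frag_of_2 bdry_frag_of_3 bdry_frag_of_4 bdry_add)
qed

section \<open>Generation of the third oriental by its atoms\<close>

text \<open>Here \<open>p\<close> is the sum of the edges of an increasing sequence from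
  \<open>s\<close> to \<open>t\<close>. A chain does not display this order, and inductions over
  1-cells need it.\<close>

inductive path :: "nat \<Rightarrow> nat \<Rightarrow> nat \<Rightarrow> chain \<Rightarrow> bool" for n where
  path_nil: "s \<le> n \<Longrightarrow> path n s s 0"
| path_cons: "i < j \<Longrightarrow> path n j t p \<Longrightarrow> path n i t (frag_of [i, j] + p)"

lemma frag_of_pos_chains_iff [simp]: "frag_of \<sigma> \<in> pos_chains n p \<longleftrightarrow> \<sigma> \<in> tuples n p"
  by (auto simp: pos_chains_iff nonneg_frag_of)

lemma tuples_list_iff [simp]:
  "[i] \<in> tuples n 0 \<longleftrightarrow> i \<le> n"
  "[i, j] \<in> tuples n (Suc 0) \<longleftrightarrow> i < j \<and> j \<le> n"
  "[i, j, k] \<in> tuples n 2 \<longleftrightarrow> i < j \<and> j < k \<and> k \<le> n"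
  "[i, j, k, l] \<in> tuples n 3 \<longleftrightarrow> i < j \<and> j < k \<and> k < l \<and> l \<le> n"
  by (auto simp: tuples_def)

lemma augm_simps [simp]:
  "augm 0 = 0" "augm (frag_of \<sigma>) = 1" "augm (c + d) = augm c + augm d" "augm (c - d) = augm c - augm d"
  by (simp_all add: augm_eq_linear_ext)

text \<open>The number \<open>augm p\<close> counts the edges, and each edge climbs by at least one.
  The two bounds on it are what isolates the principal cell in
  \<open>principal_or_degenerate\<close>.\<close>

lemma pathD:
  assumes "path n s t p"
  shows "s \<le> t" "t \<le> n" "p \<in> pos_chains n 1" "bdry p = frag_of [t] - frag_of [s]"
    "augm p \<le> int t - int s" "s < t \<Longrightarrow> 1 \<le> augm p"
proof -
  have "s \<le> t \<and> t \<le> n \<and> p \<in> pos_chains n 1 \<and> bdry p = frag_of [t] - frag_of [s]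
      \<and> augm p \<le> int t - int s \<and> (s < t \<longrightarrow> 1 \<le> augm p) \<and> 0 \<le> augm p"
    using assms by induction (auto intro: pos_chains.plus)
  then show "s \<le> t" "t \<le> n" "p \<in> pos_chains n 1" "bdry p = frag_of [t] - frag_of [s]"
    "augm p \<le> int t - int s" "s < t \<Longrightarrow> 1 \<le> augm p" by auto
qed

lemma linear_ext_cmul [simp]: "linear_ext w (frag_cmul a c) = a * linear_ext w c"
  by (subst linear_ext_superset[of "Poly_Mapping.keys c"])
    (auto simp: linear_ext_def sum_distrib_left mult.assoc)

lemma linear_ext_sum: "linear_ext w (sum f S) = (\<Sum>i\<in>S. linear_ext w (f i))"
  by (induction S rule: infinite_finite_induct) auto

lemma linear_ext_frag_extend: "linear_ext w (frag_extend g c) = linear_ext (\<lambda>\<sigma>. linear_ext w (g \<sigma>)) c"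
  by (simp add: frag_extend_def linear_ext_sum) (simp add: linear_ext_def)

lemma linear_ext_bdry: "linear_ext w (bdry c) = linear_ext (\<lambda>\<sigma>. linear_ext w (bdry (frag_of \<sigma>))) c"
  by (subst bdry_eq_frag_extend) (rule linear_ext_frag_extend)

lemma linear_ext_cong:
  "(\<And>\<sigma>. \<sigma> \<in> Poly_Mapping.keys c \<Longrightarrow> w \<sigma> = w' \<sigma>) \<Longrightarrow> linear_ext w c = linear_ext w' c"
  by (simp add: linear_ext_def)

text \<open>Weight every vertex by its label: the boundary of each edge then has weight at least 1,
  so a positive chain without boundary has no edges.\<close>

lemma cycle_eq_0:
  assumes "p \<in> pos_chains n 1" "bdry p = 0"
  shows "p = 0"
proof -
  define w :: "nat list \<Rightarrow> int" where "w \<sigma> = int (hd \<sigma>)" for \<sigma>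
  have p: "nonneg p" "Poly_Mapping.keys p \<subseteq> tuples n 1"
    using assms(1) by (auto simp: pos_chains_iff)
  have "augm p \<le> linear_ext (\<lambda>\<sigma>. linear_ext w (bdry (frag_of \<sigma>))) p"
    unfolding augm_eq_linear_ext
  proof (rule nonneg_linear_ext_mono[OF p(1)])
    fix \<sigma> assume "\<sigma> \<in> Poly_Mapping.keys p"
    then obtain i j where "\<sigma> = [i, j]" "i < j"
      using p(2) tuples_2 by blast
    then show "1 \<le> linear_ext w (bdry (frag_of \<sigma>))"
      by (simp add: w_def)
  qed
  also have "\<dots> = 0"
    using assms(2) by (simp flip: linear_ext_bdry)
  finally show ?thesis
    using nonneg_augm_pos[OF p(1)] by fastforce
qed

text \<open>Since \<open>[s]\<close> has a negative coefficient in the boundary, some edge of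
  \<open>p\<close> starts at \<open>s\<close>; removing it leaves a shorter chain of the same
  kind.\<close>

lemma pathI:
  assumes "p \<in> pos_chains n 1" "s \<le> n" "t \<le> n" "bdry p = frag_of [t] - frag_of [s]"
  shows "path n s t p"
  using assms
proof (induction "nat (augm p)" arbitrary: p s rule: less_induct)
  case less
  show ?case
  proof (cases "s = t")
    case True
    then show ?thesis
      using cycle_eq_0[of p n] less.prems path_nil by simp
  next
    case False
    have "Poly_Mapping.lookup (bdry p) [s] < 0"
      using False less.prems(4) by (simp add: lookup_minus)
    then obtain \<sigma> where \<sigma>: "\<sigma> \<in> Poly_Mapping.keys p" "Poly_Mapping.lookup (bdry (frag_of \<sigma>)) [s] < 0"
      using negative_coefficient[OF less.prems(1)] unfolding lookup_bdry[of p] by blast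
    have "\<sigma> \<in> tuples n 1"
      using \<sigma>(1) less.prems(1) unfolding pos_chains_iff by blast
    then obtain i j where ij: "\<sigma> = [i, j]" "i < j" "j \<le> n"
      using tuples_2 by blast
    with \<sigma>(2) have "i = s"
      by (auto simp: lookup_minus split: if_splits)
    have "p \<noteq> 0" using \<sigma>(1) by auto
    then have "0 < augm p"
      using less.prems(1) nonneg_augm_pos pos_chains_iff by blast
    then have "path n j t (p - frag_of \<sigma>)"
      using less.prems ij \<open>i = s\<close> \<sigma>(1)
      by (intro less.hyps) (auto intro!: pos_chains_diff)
    then have "path n s t (frag_of [s, j] + (p - frag_of \<sigma>))"
      using ij \<open>i = s\<close> by (intro path_cons) auto
    then show ?thesis
      using ij \<open>i = s\<close> by simp
  qed
qed

lemma path_append: "path n s t p \<Longrightarrow> path n t u q \<Longrightarrow> path n s u (p + q)"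
  by (induction rule: path.induct) (auto simp: add.assoc intro: path.intros)

text \<open>Factors a 1-cell around one of its edges; the outer parts \<open>L\<close> and
  \<open>R\<close> become the whiskers in \<open>agree_2\<close>.\<close>

lemma path_split:
  assumes "path n s t p" "0 < Poly_Mapping.lookup p [i, k]"
  obtains L R where "path n s i L" "path n k t R" "p = L + frag_of [i, k] + R"
proof -
  have "\<exists>L R. path n s i L \<and> path n k t R \<and> p = L + frag_of [i, k] + R"
    using assms
  proof induction
    case (path_cons a b t p)
    show ?case
    proof (cases "[i, k] = [a, b]")
      case True
      have "path n a a 0"
        using path_cons.hyps pathD[OF path_cons.hyps(2)] by (intro path_nil) auto
      then show ?thesis
        using path_cons.hyps True by (intro exI[of _ 0] exI[of _ p]) auto
    next
      case False
      then obtain L R where "path n b i L" "path n k t R" "p = L + frag_of [i, k] + R"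
        using path_cons by (auto simp: lookup_add split: if_splits)
      then show ?thesis
        using path_cons.hyps
        by (intro exI[of _ "frag_of [a, b] + L"] exI[of _ R]) (auto simp: add.assoc intro: path.intros)
    qed
  qed auto
  with that show thesis by blast
qed

text \<open>The long edge of a triangle of maximal length in \<open>c\<close> cannot cancel in the boundary of \<open>c\<close>.\<close>

lemma longest_triangle:
  assumes c: "c \<in> pos_chains n 2" "c \<noteq> 0" and pq: "nonneg q" "bdry c = q - p"
  obtains i j k where "[i, j, k] \<in> Poly_Mapping.keys c" "i < j" "j < k" "k \<le> n"
    "0 < Poly_Mapping.lookup p [i, k]"
proof -
  let ?len = "\<lambda>\<sigma>. \<sigma> ! 2 - \<sigma> ! 0 :: nat"
  define M where "M = Max (?len ` Poly_Mapping.keys c)"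
  have "Poly_Mapping.keys c \<noteq> {}" using c(2) by simp
  then have "M \<in> ?len ` Poly_Mapping.keys c"
    unfolding M_def by (intro Max_in) auto
  then obtain \<tau> where \<tau>: "\<tau> \<in> Poly_Mapping.keys c" "M = ?len \<tau>" by auto
  have max: "?len \<sigma> \<le> M" if "\<sigma> \<in> Poly_Mapping.keys c" for \<sigma>
    unfolding M_def using that by (intro Max_ge) auto
  have tup: "Poly_Mapping.keys c \<subseteq> tuples n 2" "nonneg c"
    using c(1) by (auto simp: pos_chains_iff)
  obtain i j k where ijk: "\<tau> = [i, j, k]" "i < j" "j < k" "k \<le> n"
    using \<tau>(1) tup tuples_3 by blast
  let ?w = "\<lambda>\<sigma>. Poly_Mapping.lookup (bdry (frag_of \<sigma>)) [i, k]"
  \<comment> \<open>An edge has positive sign only as a short side of a triangle, and a triangle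
    with short side \<open>[i, k]\<close> would be longer than \<open>M\<close>.\<close>
  have le: "?w \<sigma> \<le> 0" if \<sigma>: "\<sigma> \<in> Poly_Mapping.keys c" for \<sigma>
  proof -
    obtain a b d where abd: "\<sigma> = [a, b, d]" "a < b" "b < d"
      using \<sigma> tup tuples_3 by blast
    have "d - a \<le> k - i"
      using max[OF \<sigma>] \<tau>(2) ijk abd by simp
    then show ?thesis
      using abd by (auto simp: lookup_minus lookup_add split: if_splits)
  qed
  have "linear_ext ?w c = linear_ext ?w (c - frag_of \<tau>) + ?w \<tau>"
    by simp
  also have "linear_ext ?w (c - frag_of \<tau>) \<le> linear_ext (\<lambda>_. 0) (c - frag_of \<tau>)"
    using le keys_diff_frag_of[OF \<tau>(1)] by (intro nonneg_linear_ext_mono nonneg_diff tup \<tau>) auto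
  also have "\<dots> = 0"
    by (simp add: linear_ext_def)
  also have "?w \<tau> < 0"
    using ijk by (auto simp: lookup_minus lookup_add)
  finally have "Poly_Mapping.lookup (bdry c) [i, k] < 0"
    by (simp add: lookup_bdry[of c])
  \<comment> \<open>As \<open>q\<close> is nonnegative, a negative coefficient of
    \<open>q - p\<close> must come from \<open>p\<close>.\<close>
  then have "0 < Poly_Mapping.lookup p [i, k]"
    using pq by (auto simp: lookup_minus nonneg_def) (smt (verit))
  with that \<tau>(1) ijk show thesis by blast
qed

section \<open>Functors on an oriental that agree on atoms\<close>

lemma omega_homD:
  assumes "x \<in> omega_hom D A"
  shows "c \<in> cells D k \<Longrightarrow> x k c \<in> cells A k"
    "c \<in> cells D (Suc k) \<Longrightarrow> src A k (x (Suc k) c) = x k (src D k c)"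
    "c \<in> cells D (Suc k) \<Longrightarrow> tgt A k (x (Suc k) c) = x k (tgt D k c)"
    "c \<in> cells D k \<Longrightarrow> x (Suc k) (idn D k c) = idn A k (x k c)"
    "composable D i k d c \<Longrightarrow> x k (cmp D i k d c) = cmp A i k (x k d) (x k c)"
    "x k \<in> extensional (cells D k)"
  using assms by (auto simp: omega_hom_def omega_functor_def)

lemma hom_idn:
  "x \<in> omega_hom (oriental n) A \<Longrightarrow> c \<in> cells (oriental n) k \<Longrightarrow> x (Suc k) c = idn A k (x k c)"
  using omega_homD(4)[of x "oriental n" A c k] by (simp add: oriental_simps)

context
  fixes A :: "'a ocat" and n :: nat and x x' :: "nat \<Rightarrow> table \<Rightarrow> 'a"
  assumes homs: "x \<in> omega_hom (oriental n) A" "x' \<in> omega_hom (oriental n) A"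
begin

lemma agree_idn:
  assumes "c \<in> cells (oriental n) k" "x k c = x' k c" "k \<le> l"
  shows "x l c = x' l c"
  using assms(3)
proof (induction rule: dec_induct)
  case (step l)
  then have "c \<in> cells (oriental n) l"
    using cells_mono assms(1) by blast
  then show ?case
    using hom_idn[OF homs(1), of c l] hom_idn[OF homs(2), of c l] step by simp
qed (rule assms)

lemma agree_cmp:
  "composable (oriental n) i k d c \<Longrightarrow> x k c = x' k c \<Longrightarrow> x k d = x' k d \<Longrightarrow>
   x k (cmp (oriental n) i k d c) = x' k (cmp (oriental n) i k d c)"
  using omega_homD(5)[OF homs(1)] omega_homD(5)[OF homs(2)] by metis

lemma agree_1:
  assumes "path n s t p"
    and "\<And>i. i \<le> n \<Longrightarrow> x 0 (atom [i]) = x' 0 (atom [i])"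
    and "\<And>i j. i < j \<Longrightarrow> j \<le> n \<Longrightarrow> x 1 (atom [i, j]) = x' 1 (atom [i, j])"
  shows "x 1 (tab1 (frag_of [s]) (frag_of [t]) p) = x' 1 (tab1 (frag_of [s]) (frag_of [t]) p)"
  using assms(1)
proof induction
  case (path_nil s)
  then show ?case
    using assms(2)[of s]
    by - (rule agree_idn[where k = 0], auto simp: atom_1 tab_in_cells)
next
  case (path_cons i j t p)
  note p = pathD[OF path_cons.hyps(2)]
  let ?c = "tab1 (frag_of [i]) (frag_of [j]) (frag_of [i, j])"
  let ?d = "tab1 (frag_of [j]) (frag_of [t]) p"
  have eq: "tab1 (frag_of [i]) (frag_of [t]) (frag_of [i, j] + p) = cmp (oriental n) 0 1 ?d ?c"
    by (simp add: cmp_tab add.commute)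
  have comp: "composable (oriental n) 0 1 ?d ?c"
    using path_cons.hyps p
    by (simp add: composable_def tab_in_cells isrc_numeral itgt_numeral src_tab tgt_tab)
  have c: "x 1 ?c = x' 1 ?c"
    using assms(3)[of i j] path_cons.hyps p by (simp add: atom_2)
  show ?case
    unfolding eq by (rule agree_cmp[OF comp c path_cons.IH])
qed

text \<open>A longest triangle of \<open>c\<close> has its long edge on the source path
  \<open>p\<close>, so it can be applied first: the cell is this triangle, whiskered by the rest of
  \<open>p\<close>, followed by a cell with one triangle fewer.\<close>

lemma agree_2:
  assumes "c \<in> pos_chains n 2" "path n s t p" "path n s t q" "bdry c = q - p"
    and vertices: "\<And>i. i \<le> n \<Longrightarrow> x 0 (atom [i]) = x' 0 (atom [i])"
    and edges: "\<And>i j. i < j \<Longrightarrow> j \<le> n \<Longrightarrow> x 1 (atom [i, j]) = x' 1 (atom [i, j])"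
    and triangles: "\<And>i j k. i < j \<Longrightarrow> j < k \<Longrightarrow> k \<le> n \<Longrightarrow> x 2 (atom [i, j, k]) = x' 2 (atom [i, j, k])"
  shows "x 2 (tab2 (frag_of [s]) (frag_of [t]) p q c) = x' 2 (tab2 (frag_of [s]) (frag_of [t]) p q c)"
  using assms(1,2,4)
proof (induction "nat (augm c)" arbitrary: c p rule: less_induct)
  case less
  note q = pathD[OF assms(3)] and p = pathD[OF less.prems(2)]
  show ?case
  proof (cases "c = 0")
    case True
    then show ?thesis
      using agree_1[OF assms(3) vertices edges] less.prems q
      by - (rule agree_idn[where k = 1], auto simp: tab_in_cells)
  next
    case False
    have "nonneg q" using q(3) pos_chains_iff by blast
    then obtain i j k where ijk: "[i, j, k] \<in> Poly_Mapping.keys c" "i < j" "j < k" "k \<le> n"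
        "0 < Poly_Mapping.lookup p [i, k]"
      using longest_triangle[OF less.prems(1) False _ less.prems(3)] by blast
    obtain L R where LR: "path n s i L" "path n k t R" "p = L + frag_of [i, k] + R"
      using path_split[OF less.prems(2) ijk(5)] .
    note L = pathD[OF LR(1)] and R = pathD[OF LR(2)]
    \<comment> \<open>The path \<open>p\<close> with its edge \<open>[i, k]\<close> replaced by the
      two short sides of the triangle.\<close>
    define m where "m = L + (frag_of [i, j] + (frag_of [j, k] + R))"
    have m: "path n s t m"
      unfolding m_def using LR ijk by (intro path_append[OF LR(1)] path_cons)
    note m' = pathD[OF m]
    let ?\<tau> = "frag_of [i, j, k]" and ?s = "frag_of [s]" and ?t = "frag_of [t]"
    have bd: "bdry (c - ?\<tau>) = q - m"
      using less.prems(3) by (simp add: m_def LR(3) algebra_simps)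
    have pos: "c - ?\<tau> \<in> pos_chains n 2"
      using less.prems(1) ijk(1) by (rule pos_chains_diff)
    have "0 < augm c"
      using False less.prems(1) nonneg_augm_pos pos_chains_iff by blast
    then have IH: "x 2 (tab2 ?s ?t m q (c - ?\<tau>)) = x' 2 (tab2 ?s ?t m q (c - ?\<tau>))"
      using bd pos m by (intro less.hyps) auto
    have bdm: "bdry ?\<tau> = m - p"
      by (simp add: m_def LR(3) algebra_simps)
    let ?a = "tab2 (frag_of [i]) (frag_of [k]) (frag_of [i, k]) (frag_of [i, j] + frag_of [j, k]) ?\<tau>"
    let ?l = "tab1 ?s (frag_of [i]) L" and ?r = "tab1 (frag_of [k]) ?t R"
    have a: "x 2 ?a = x' 2 ?a"
      using triangles[of i j k] ijk by (simp add: atom_3)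
    \<comment> \<open>The whiskers are 1-cells regarded as 2-cells: the identity of a cell is the
      same table.\<close>
    have "x 2 ?l = x' 2 ?l" "x 2 ?r = x' 2 ?r"
      using agree_1[OF LR(1) vertices edges] agree_1[OF LR(2) vertices edges] L R
      by - (rule agree_idn[where k = 1], auto simp: tab_in_cells)+
    have comp1: "composable (oriental n) 0 2 ?a ?l"
      using ijk L
      by (simp add: composable_def tab_in_cells isrc_numeral itgt_numeral src_tab tgt_tab pos_chains.plus)
    have la: "cmp (oriental n) 0 2 ?a ?l = tab2 ?s (frag_of [k]) (L + frag_of [i, k])
        (L + frag_of [i, j] + frag_of [j, k]) ?\<tau>"
      by (simp add: cmp_tab algebra_simps)
    have comp2: "composable (oriental n) 0 2 ?r (cmp (oriental n) 0 2 ?a ?l)"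
      unfolding la using ijk L R
      by (simp add: composable_def tab_in_cells isrc_numeral itgt_numeral src_tab tgt_tab pos_chains.plus)
    have rla: "cmp (oriental n) 0 2 ?r (cmp (oriental n) 0 2 ?a ?l) = tab2 ?s ?t p m ?\<tau>"
      unfolding la by (simp add: cmp_tab LR(3) m_def algebra_simps)
    have "x 2 (tab2 ?s ?t p m ?\<tau>) = x' 2 (tab2 ?s ?t p m ?\<tau>)"
      unfolding rla[symmetric]
      by (rule agree_cmp[OF comp2 agree_cmp[OF comp1]]) fact+
    moreover have "composable (oriental n) 1 2 (tab2 ?s ?t m q (c - ?\<tau>)) (tab2 ?s ?t p m ?\<tau>)"
      using ijk p m' q pos bd bdm less.prems
      by (simp add: composable_def tab_in_cells isrc_numeral itgt_numeral src_tab tgt_tab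
          del: bdry_frag_of_3 bdry_diff)
    moreover have "cmp (oriental n) 1 2 (tab2 ?s ?t m q (c - ?\<tau>)) (tab2 ?s ?t p m ?\<tau>)
        = tab2 ?s ?t p q c"
      by (simp add: cmp_tab)
    ultimately show ?thesis
      using agree_cmp IH by metis
  qed
qed

end

section \<open>The only 3-cell of the third oriental that is not an identity\<close>

lemma augm_bdry:
  assumes "c \<in> pos_chains n 2"
  shows "augm (bdry c) = augm c"
  unfolding augm_eq_linear_ext linear_ext_bdry[of _ c]
proof (rule linear_ext_cong)
  fix \<sigma> assume "\<sigma> \<in> Poly_Mapping.keys c"
  then have "\<sigma> \<in> tuples n 2"
    using assms unfolding pos_chains_iff by blast
  then obtain i j k where "\<sigma> = [i, j, k]"
    using tuples_3 by blast
  then show "linear_ext (\<lambda>_. 1) (bdry (frag_of \<sigma>)) = 1"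
    by simp
qed

text \<open>Counting edges: each triangle of the source \<open>s2\<close> lengthens the path by one,
  by \<open>augm_bdry\<close>. A nonzero top entry forces the triangles 012 and 023 into
  \<open>s2\<close>, while a path in [3] has at most three edges. Hence the source path is the
  single edge 03 and \<open>s2\<close> has no further triangle.\<close>

lemma principal_or_degenerate:
  assumes "c \<in> cells (oriental 3) 3"
  shows "c = atom [0, 1, 2, 3] \<or> c \<in> cells (oriental 3) 2"
proof (cases "c 3 False = 0")
  case True
  then show ?thesis
    using cells_pred[of c 3 2] assms by (simp add: eval_nat_numeral)
next
  case False
  define s0 t0 s1 t1 s2 t2 c3 where defs: "s0 = c 0 False" "t0 = c 0 True" "s1 = c 1 False"
    "t1 = c 1 True" "s2 = c 2 False" "t2 = c 2 True" "c3 = c 3 False"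
  have c: "c = tab s0 t0 s1 t1 s2 t2 c3"
    unfolding defs by (rule cell_eq_tab[OF assms]) simp
  note * = assms[unfolded c tab_in_cells_3]
  obtain s where s: "s \<le> 3" "s0 = frag_of [s]"
    using * pos_chains_augm_1[of s0 3 0] tuples_1 by metis
  obtain t where t: "t \<le> 3" "t0 = frag_of [t]"
    using * pos_chains_augm_1[of t0 3 0] tuples_1 by metis
  have paths: "path 3 s t s1" "path 3 s t t1"
    using * s t by (auto intro!: pathI)
  note p = pathD[OF paths(1)] and q = pathD[OF paths(2)]
  have tup: "tuples 3 3 = {[0, 1, 2, 3]}"
    by (auto simp: tuples_4)
  have keys: "Poly_Mapping.keys c3 = {[0, 1, 2, 3]}"
    using * False tup unfolding pos_chains_iff defs(7)
    by (metis keys_eq_empty subset_singletonD)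
  define m where "m = Poly_Mapping.lookup c3 [0, 1, 2, 3]"
  have m: "1 \<le> m"
    using * keys nonneg_keys[of c3 "[0, 1, 2, 3]"] by (auto simp: pos_chains_iff m_def)
  have lookup: "Poly_Mapping.lookup (bdry c3) \<rho> = m * Poly_Mapping.lookup (bdry (frag_of [0, 1, 2, 3])) \<rho>" for \<rho>
    by (simp add: lookup_bdry[of c3] linear_ext_def keys m_def)
  have nonneg: "nonneg s2" "nonneg t2" using * pos_chains_iff by auto
  \<comment> \<open>The boundary of \<open>c3\<close>, which is \<open>t2 - s2\<close>, has
    coefficient \<open>-m\<close> here, and \<open>t2\<close> contributes nonnegatively.\<close>
  have l012: "m \<le> Poly_Mapping.lookup s2 [0, 1, 2]"
    using lookup[of "[0, 1, 2]"] * nonneg by (auto simp: lookup_minus lookup_add nonneg_def) (smt (verit))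
  have l023: "m \<le> Poly_Mapping.lookup s2 [0, 2, 3]"
    using lookup[of "[0, 2, 3]"] * nonneg by (auto simp: lookup_minus lookup_add nonneg_def) (smt (verit))
  define r where "r = s2 - frag_of [0, 1, 2] - frag_of [0, 2, 3]"
  have k012: "[0, 1, 2] \<in> Poly_Mapping.keys s2"
    using l012 m by (simp add: in_keys_iff)
  have k023: "[0, 2, 3] \<in> Poly_Mapping.keys (s2 - frag_of [0, 1, 2])"
    using l023 m by (simp add: in_keys_iff lookup_minus)
  have r: "r \<in> pos_chains 3 2"
    unfolding r_def using * k012 k023 by (intro pos_chains_diff) auto
  have "augm t1 - augm s1 = augm (bdry s2)"
    using * by simp
  also have "\<dots> = augm s2"
    using * augm_bdry by blast
  also have "\<dots> = 2 + augm r"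
    by (simp add: r_def)
  finally have eq: "augm t1 - augm s1 = 2 + augm r" .
  have "0 \<le> augm r"
    using r nonneg_linear_ext[of r "\<lambda>_. 1"] by (auto simp: pos_chains_iff augm_eq_linear_ext)
  moreover have "0 \<le> augm s1"
    using * nonneg_linear_ext[of s1 "\<lambda>_. 1"] by (auto simp: pos_chains_iff augm_eq_linear_ext)
  moreover have "s < t"
    using q(1,5) eq calculation by linarith
  \<comment> \<open>By now \<open>augm t1\<close> exceeds \<open>augm s1 \<ge> 1\<close> by at least
    2, and it is at most \<open>t - s \<le> 3\<close>; so every inequality is an equality.\<close>
  ultimately have "augm r = 0" "augm s1 = 1" "s = 0" "t = 3"
    using p(6) q(5) eq s t by linarith+
  then have "r = 0"
    using r pos_chains_augm_0 by blast
  then have s2: "s2 = frag_of [0, 1, 2] + frag_of [0, 2, 3]"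
    by (simp add: r_def algebra_simps)
  then have "m = 1"
    using l012 m by (simp add: lookup_add)
  have c3: "c3 = frag_of [0, 1, 2, 3]"
  proof (rule poly_mapping_eqI)
    fix \<rho>
    show "Poly_Mapping.lookup c3 \<rho> = Poly_Mapping.lookup (frag_of [0, 1, 2, 3]) \<rho>"
      using \<open>m = 1\<close> keys m_def in_keys_iff[of \<rho> c3] by (cases "\<rho> = [0, 1, 2, 3]") simp_all
  qed
  have t2: "t2 = frag_of [1, 2, 3] + frag_of [0, 1, 3]"
    using * by (simp add: c3 s2 algebra_simps)
  obtain \<sigma> where \<sigma>: "\<sigma> \<in> tuples 3 1" "s1 = frag_of \<sigma>"
    using * \<open>augm s1 = 1\<close> pos_chains_augm_1 by metis
  then obtain i j where ij: "s1 = frag_of [i, j]" "i < j"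
    using tuples_2 by auto
  have "Poly_Mapping.lookup (bdry s1) [0] = -1" "Poly_Mapping.lookup (bdry s1) [3] = 1"
    using * s t \<open>s = 0\<close> \<open>t = 3\<close> by (auto simp: lookup_minus)
  then have "s1 = frag_of [0, 3]"
    using ij by (auto simp: lookup_minus split: if_splits)
  moreover have "t1 = s1 + bdry s2" using * by simp
  ultimately show ?thesis
    using s t \<open>s = 0\<close> \<open>t = 3\<close> by (simp add: c c3 s2 t2 atom_4 tab_eq_iff)
qed

section \<open>Orientals as categories\<close>

lemma itgt_same [simp]: "itgt C i i x = x"
  by (cases i) auto

lemma isrc_same [simp]: "isrc C i i x = x"
  by (cases i) auto

text \<open>In an oriental \<open>tgt\<close> truncates the table at degree \<open>i\<close>
  whatever the dimension of the cell, so the intermediate truncations are absorbed.\<close>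

lemma itgt_oriental: "i < k \<Longrightarrow> itgt (oriental n) i k x = tgt (oriental n) i x"
proof (induction k arbitrary: x)
  case (Suc k)
  then show ?case
    by (cases "i = k") (auto simp: oriental_simps fun_eq_iff)
qed simp

lemma isrc_oriental: "i < k \<Longrightarrow> isrc (oriental n) i k x = src (oriental n) i x"
proof (induction k arbitrary: x)
  case (Suc k)
  then show ?case
    by (cases "i = k") (auto simp: oriental_simps fun_eq_iff)
qed simp

lemma composable_oriental:
  "composable (oriental n) i k d c \<longleftrightarrow> i < k \<and> c \<in> cells (oriental n) k \<and>
     d \<in> cells (oriental n) k \<and> tgt (oriental n) i c = src (oriental n) i d"
  by (auto simp: composable_def itgt_oriental isrc_oriental)

lemma src_oriental_cell:
  assumes "c \<in> cells (oriental n) (Suc k)"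
  shows "src (oriental n) k c \<in> cells (oriental n) k"
proof (rule oriental_cellsI)
  note c = oriental_cellsD[OF assms]
  show "src (oriental n) k c p \<epsilon> \<in> pos_chains n p" if "p \<le> k" for p \<epsilon>
    using that c(1) by (simp add: oriental_simps)
  show "bdry (src (oriental n) k c (Suc p) \<epsilon>)
      = src (oriental n) k c p True - src (oriental n) k c p False" if "p < k" for p \<epsilon>
    using that c(3)[of p \<epsilon>] c(3)[of p False] by (cases "Suc p = k") (auto simp: oriental_simps)
qed (use oriental_cellsD[OF assms] in \<open>auto simp: oriental_simps\<close>)

lemma tgt_oriental_cell:
  assumes "c \<in> cells (oriental n) (Suc k)"
  shows "tgt (oriental n) k c \<in> cells (oriental n) k"
proof (rule oriental_cellsI)
  note c = oriental_cellsD[OF assms]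
  show "tgt (oriental n) k c p \<epsilon> \<in> pos_chains n p" if "p \<le> k" for p \<epsilon>
    using that c(1) by (simp add: oriental_simps)
  show "bdry (tgt (oriental n) k c (Suc p) \<epsilon>)
      = tgt (oriental n) k c p True - tgt (oriental n) k c p False" if "p < k" for p \<epsilon>
    using that c(3)[of p \<epsilon>] c(3)[of p True] by (cases "Suc p = k") (auto simp: oriental_simps)
qed (use oriental_cellsD[OF assms] in \<open>auto simp: oriental_simps\<close>)

lemma cmp_oriental_cell:
  assumes "composable (oriental n) i k d c"
  shows "cmp (oriental n) i k d c \<in> cells (oriental n) k"
proof (rule oriental_cellsI)
  have i: "i < k" and c: "c \<in> cells (oriental n) k" and d: "d \<in> cells (oriental n) k"
    and eq: "tgt (oriental n) i c = src (oriental n) i d"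
    using assms by (auto simp: composable_oriental)
  note cD = oriental_cellsD[OF c] and dD = oriental_cellsD[OF d]
  have low: "c p \<epsilon> = d p \<epsilon>" if "p < i" for p \<epsilon>
    using that fun_cong[OF fun_cong[OF eq], of p \<epsilon>] by (simp add: oriental_simps)
  have mid: "c i True = d i False"
    using fun_cong[OF fun_cong[OF eq], of i False] by (simp add: oriental_simps)
  show "cmp (oriental n) i k d c p \<epsilon> \<in> pos_chains n p" if "p \<le> k" for p \<epsilon>
    using that cD(1) dD(1) by (auto simp: oriental_simps intro: pos_chains.plus)
  show "bdry (cmp (oriental n) i k d c (Suc p) \<epsilon>)
      = cmp (oriental n) i k d c p True - cmp (oriental n) i k d c p False" if p: "p < k" for p \<epsilon>
  proof -
    consider "p < i" | "p = i" | "i < p" by linarith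
    then show ?thesis
    proof cases
      case 1
      then show ?thesis
        using p cD(3)[of p \<epsilon>] dD(3)[of p \<epsilon>] cD(3)[of p False] dD(3)[of p True] low
        by (auto simp: oriental_simps)
    next
      \<comment> \<open>The two boundaries telescope: the target of \<open>c\<close> in degree
        \<open>i\<close> cancels against the source of \<open>d\<close>.\<close>
      case 2
      then show ?thesis
        using p cD(3)[of p \<epsilon>] dD(3)[of p \<epsilon>] mid by (simp add: oriental_simps)
    next
      case 3
      then show ?thesis
        using p cD(3)[of p \<epsilon>] dD(3)[of p \<epsilon>] by (simp add: oriental_simps)
    qed
  qed
  show "cmp (oriental n) i k d c p \<epsilon> = 0" if "k < p" for p \<epsilon>
    using that i cD(2) dD(2) by (simp add: oriental_simps)
  show "augm (cmp (oriental n) i k d c 0 \<epsilon>) = 1" for \<epsilon>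
    using cD(4) dD(4) by (simp add: oriental_simps)
  show "cmp (oriental n) i k d c k False = cmp (oriental n) i k d c k True"
    using i cD(5) dD(5) by (simp add: oriental_simps)
qed

subsection \<open>Functors induced by chain maps\<close>

definition lift :: "(nat list \<Rightarrow> chain) \<Rightarrow> table \<Rightarrow> table" where
  "lift g c = (\<lambda>p \<epsilon>. frag_extend g (c p \<epsilon>))"

text \<open>A morphism of augmented directed complexes, given on basis tuples. Values may be sums of
  tuples, which \<open>collapse\<close> needs and a map of vertices cannot provide.\<close>

definition directed_map :: "nat \<Rightarrow> nat \<Rightarrow> (nat list \<Rightarrow> chain) \<Rightarrow> bool" where
  "directed_map m n g \<longleftrightarrow>
     (\<forall>p. \<forall>\<sigma> \<in> tuples m p. g \<sigma> \<in> pos_chains n p) \<and>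
     (\<forall>p. \<forall>\<sigma> \<in> tuples m (Suc p). bdry (g \<sigma>) = frag_extend g (bdry (frag_of \<sigma>))) \<and>
     (\<forall>\<sigma> \<in> tuples m 0. augm (g \<sigma>) = 1)"

definition pullback :: "nat \<Rightarrow> (nat list \<Rightarrow> chain) \<Rightarrow> (nat \<Rightarrow> table \<Rightarrow> 'a) \<Rightarrow> nat \<Rightarrow> table \<Rightarrow> 'a" where
  "pullback m g x = (\<lambda>k. restrict (\<lambda>c. x k (lift g c)) (cells (oriental m) k))"

lemma frag_extend_pos_chains:
  assumes "c \<in> pos_chains m p" "\<And>\<sigma>. \<sigma> \<in> tuples m p \<Longrightarrow> g \<sigma> \<in> pos_chains n p"
  shows "frag_extend g c \<in> pos_chains n p"
  using assms(1) by induction (auto simp: frag_extend_add assms(2) intro: pos_chains.plus)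

lemma frag_extend_bdry:
  assumes "c \<in> pos_chains m (Suc p)"
    and "\<And>\<sigma>. \<sigma> \<in> tuples m (Suc p) \<Longrightarrow> bdry (g \<sigma>) = frag_extend g (bdry (frag_of \<sigma>))"
  shows "bdry (frag_extend g c) = frag_extend g (bdry c)"
  using assms(1) by induction (auto simp: frag_extend_add assms(2))

lemma augm_frag_extend:
  assumes "c \<in> pos_chains m p" "\<And>\<sigma>. \<sigma> \<in> tuples m p \<Longrightarrow> augm (g \<sigma>) = 1"
  shows "augm (frag_extend g c) = augm c"
  using assms(1) by induction (auto simp: frag_extend_add assms(2))

lemma lift_cell:
  assumes g: "directed_map m n g" and "c \<in> cells (oriental m) k"
  shows "lift g c \<in> cells (oriental n) k"
proof (rule oriental_cellsI)
  note c = oriental_cellsD[OF assms(2)]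
  show "lift g c p \<epsilon> \<in> pos_chains n p" if "p \<le> k" for p \<epsilon>
    unfolding lift_def using g
    by (intro frag_extend_pos_chains[OF c(1)[OF that]]) (simp add: directed_map_def)
  show "bdry (lift g c (Suc p) \<epsilon>) = lift g c p True - lift g c p False" if "p < k" for p \<epsilon>
    using frag_extend_bdry[of "c (Suc p) \<epsilon>" m p g] c(1)[of "Suc p" \<epsilon>] c(3)[OF that, of \<epsilon>] that g
    by (simp add: lift_def directed_map_def flip: frag_extend_diff)
  show "augm (lift g c 0 \<epsilon>) = 1" for \<epsilon>
    using augm_frag_extend[of "c 0 \<epsilon>" m 0 g] c(1)[of 0 \<epsilon>] c(4)[of \<epsilon>] g
    by (simp add: lift_def directed_map_def)
qed (use oriental_cellsD[OF assms(2)] in \<open>auto simp: lift_def\<close>)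

lemma lift_src: "lift g (src (oriental m) k c) = src (oriental n) k (lift g c)"
  by (auto simp: lift_def oriental_simps fun_eq_iff)

lemma lift_tgt: "lift g (tgt (oriental m) k c) = tgt (oriental n) k (lift g c)"
  by (auto simp: lift_def oriental_simps fun_eq_iff)

lemma lift_cmp: "lift g (cmp (oriental m) i k d c) = cmp (oriental n) i k (lift g d) (lift g c)"
  by (auto simp: lift_def oriental_simps fun_eq_iff frag_extend_add)

lemma lift_composable:
  assumes "directed_map m n g" "composable (oriental m) i k d c"
  shows "composable (oriental n) i k (lift g d) (lift g c)"
  using assms lift_tgt[of g m i c n] lift_src[of g m i d n]
  by (auto simp: composable_oriental lift_cell)

lemma pullback_apply: "c \<in> cells (oriental m) k \<Longrightarrow> pullback m g x k c = x k (lift g c)"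
  by (simp add: pullback_def)

lemma pullback_hom:
  assumes g: "directed_map m n g" and x: "x \<in> omega_hom (oriental n) A"
  shows "pullback m g x \<in> omega_hom (oriental m) A"
proof -
  note x = omega_homD[OF x]
  have "pullback m g x (Suc k) (idn (oriental m) k c) = idn A k (pullback m g x k c)"
    if "c \<in> cells (oriental m) k" for k c
    using that x(4)[OF lift_cell[OF g that]] cells_Suc[OF that]
    by (simp add: pullback_apply oriental_simps(4))
  moreover have "pullback m g x k (cmp (oriental m) i k d c)
      = cmp A i k (pullback m g x k d) (pullback m g x k c)"
    if "composable (oriental m) i k d c" for i k c d
    using that x(5)[OF lift_composable[OF g that]] cmp_oriental_cell[OF that]
    by (simp add: pullback_apply composable_oriental lift_cmp[of g m i k d c n])
  ultimately show ?thesis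
    using x(1,2,3) lift_cell[OF g] lift_src[of g m _ _ n] lift_tgt[of g m _ _ n]
    unfolding omega_hom_def omega_functor_def
    by (auto simp: pullback_apply src_oriental_cell tgt_oriental_cell) (simp add: pullback_def)
qed

definition tuple_map :: "(nat \<Rightarrow> nat) \<Rightarrow> nat list \<Rightarrow> chain" where
  "tuple_map \<theta> \<sigma> = (if sorted_wrt (<) (map \<theta> \<sigma>) then frag_of (map \<theta> \<sigma>) else 0)"

lemma street_nerve_simps:
  "simps (street_nerve A) n = omega_hom (oriental n) A"
  "pull (street_nerve A) m n \<theta> x = pullback m (tuple_map \<theta>) x"
  by (simp_all add: street_nerve_def pullback_def lift_def oriental_map_def[abs_def] chain_map_def
      tuple_map_def[abs_def])

text \<open>If two adjacent entries have the same image, the two faces omitting one of them cancel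
  and the others vanish. All simplices pulled back to along vertex maps have dimension 3, so tuples
  of at most four entries suffice.\<close>

lemma directed_map_tuple_map:
  assumes "simplex_map 3 n \<theta>"
  shows "directed_map 3 n (tuple_map \<theta>)"
proof -
  have mono: "\<theta> i \<le> \<theta> j" if "i \<le> j" "j \<le> 3" for i j
    using assms that by (auto simp: simplex_map_def mono_on_def)
  have bound: "\<theta> i \<le> n" if "i \<le> 3" for i
    using assms that by (auto simp: simplex_map_def)
  have pos: "tuple_map \<theta> \<sigma> \<in> pos_chains n p" if "\<sigma> \<in> tuples 3 p" for p \<sigma>
    using that bound by (auto simp: tuple_map_def) (auto simp: tuples_def)
  have "bdry (tuple_map \<theta> \<sigma>) = frag_extend (tuple_map \<theta>) (bdry (frag_of \<sigma>))"
    if \<sigma>: "\<sigma> \<in> tuples 3 (Suc p)" for p \<sigma>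
  proof -
    have "p \<le> 2"
      using \<sigma> tuples_empty[of 3 "Suc p"] by (cases "p \<le> 2") auto
    then consider "p = 0" | "p = 1" | "p = 2" by linarith
    then show ?thesis
    proof cases
      case 1
      then obtain i j where "\<sigma> = [i, j]" "i < j" "j \<le> 3"
        using \<sigma> tuples_2 by auto
      then show ?thesis
        using mono[of i j] by (auto simp: tuple_map_def frag_extend_diff)
    next
      case 2
      then obtain i j k where "\<sigma> = [i, j, k]" "i < j" "j < k" "k \<le> 3"
        using \<sigma> tuples_3 by (auto simp: numeral_2_eq_2)
      then show ?thesis
        using mono[of i j] mono[of j k]
        by (cases "\<theta> i = \<theta> j"; cases "\<theta> j = \<theta> k")
          (auto simp: tuple_map_def frag_extend_diff frag_extend_add)
    next
      case 3
      then obtain i j k l where "\<sigma> = [i, j, k, l]" "i < j" "j < k" "k < l" "l \<le> 3"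
        using \<sigma> tuples_4 by (auto simp: numeral_3_eq_3)
      then show ?thesis
        using mono[of i j] mono[of j k] mono[of k l]
        by (cases "\<theta> i = \<theta> j"; cases "\<theta> j = \<theta> k"; cases "\<theta> k = \<theta> l")
          (auto simp: tuple_map_def frag_extend_diff frag_extend_add)
    qed
  qed
  moreover have "augm (tuple_map \<theta> \<sigma>) = 1" if "\<sigma> \<in> tuples 3 0" for \<sigma>
    using that by (auto simp: tuples_1 tuple_map_def)
  ultimately show ?thesis
    using pos by (auto simp: directed_map_def)
qed

lemma lift_tab:
  "lift g (tab s0 t0 s1 t1 s2 t2 c) = tab (frag_extend g s0) (frag_extend g t0)
     (frag_extend g s1) (frag_extend g t1) (frag_extend g s2) (frag_extend g t2) (frag_extend g c)"
  by (auto simp: lift_def tab_def fun_eq_iff)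

lemma atom_cells:
  "i \<le> n \<Longrightarrow> atom [i] \<in> cells (oriental n) 0"
  "i < j \<Longrightarrow> j \<le> n \<Longrightarrow> atom [i, j] \<in> cells (oriental n) 1"
  "i < j \<Longrightarrow> j < k \<Longrightarrow> k \<le> n \<Longrightarrow> atom [i, j, k] \<in> cells (oriental n) 2"
  "i < j \<Longrightarrow> j < k \<Longrightarrow> k < l \<Longrightarrow> l \<le> n \<Longrightarrow> atom [i, j, k, l] \<in> cells (oriental n) 3"
  by (simp_all add: atom_1 atom_2 atom_3 atom_4 tab_in_cells pos_chains.plus)

section \<open>Simplices with trivial principal cell\<close>

lemma cells_0_cases:
  assumes "c \<in> cells (oriental n) 0"
  obtains i where "i \<le> n" "c = atom [i]"
proof -
  note c = oriental_cellsD[OF assms]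
  obtain i where "i \<le> n" "c 0 False = frag_of [i]"
    using c(1)[of 0 False] c(4)[of False] pos_chains_augm_1 tuples_1 by (metis order_refl)
  then show thesis
    using that[of i] cell_eq_tab[OF assms] c(2)[of 1] c(2)[of 2] c(2)[of 3] c(5) by (simp add: atom_1)
qed

lemma cells_2_cases:
  assumes "c \<in> cells (oriental n) 2"
  obtains s t p q r where "path n s t p" "path n s t q" "r \<in> pos_chains n 2" "bdry r = q - p"
    "c = tab2 (frag_of [s]) (frag_of [t]) p q r"
proof -
  note c = oriental_cellsD[OF assms]
  obtain s where s: "s \<le> n" "c 0 False = frag_of [s]"
    using c(1)[of 0 False] c(4)[of False] pos_chains_augm_1 tuples_1 by (metis zero_le)
  obtain t where t: "t \<le> n" "c 0 True = frag_of [t]"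
    using c(1)[of 0 True] c(4)[of True] pos_chains_augm_1 tuples_1 by (metis zero_le)
  have "path n s t (c 1 False)" "path n s t (c 1 True)"
    using c(1)[of 1] c(3)[of 0] s t by (auto intro!: pathI)
  moreover have "c 2 False \<in> pos_chains n 2" "bdry (c 2 False) = c 1 True - c 1 False"
    using c(1)[of 2 False] c(3)[of 1 False] by (auto simp: numeral_2_eq_2)
  ultimately show thesis
    using that cell_eq_tab[OF assms] c(2)[of 3] c(5) s t by simp
qed

lemma cells_1_cases:
  assumes "c \<in> cells (oriental n) 1"
  obtains s t p where "path n s t p" "c = tab1 (frag_of [s]) (frag_of [t]) p"
proof -
  have c2: "c \<in> cells (oriental n) 2"
    by (rule cells_mono[OF _ assms]) simp
  note c = oriental_cellsD[OF assms]
  obtain s t p q r where *: "path n s t p" "path n s t q" "c = tab2 (frag_of [s]) (frag_of [t]) p q r"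
    using cells_2_cases[OF c2] by metis
  have "r = c 2 False" "p = c 1 False" "q = c 1 True"
    using *(3) by (simp_all add: tab_def)
  then have "r = 0" "p = q"
    using c(2)[of 2 False] c(5) by auto
  then show thesis
    using that * by blast
qed

text \<open>An identity is the identity of its source and of its target. So a trivial principal cell
  is determined in dimension 2, and its existence is an equation between 2-cells.\<close>

lemma trivial_principal_eq:
  assumes A: "strict_omega_category A" and x: "x \<in> omega_hom (oriental 3) A"
    and "trivial_principal A x"
  shows "x 3 (atom [0, 1, 2, 3]) = idn A 2 (x 2 (src (oriental 3) 2 (atom [0, 1, 2, 3])))"
    and "x 2 (src (oriental 3) 2 (atom [0, 1, 2, 3])) = x 2 (tgt (oriental 3) 2 (atom [0, 1, 2, 3]))"
proof -
  interpret strict_omega_category A by (rule A)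
  let ?a = "atom [0, 1, 2, 3]"
  have a: "?a \<in> cells (oriental 3) (Suc 2)"
    using atom_cells(4)[of 0 1 2 3 3] by (simp add: eval_nat_numeral)
  obtain y where y: "y \<in> cells A 2" "x (Suc 2) ?a = idn A 2 y"
    using assms(3) by (auto simp: trivial_principal_def trivial_cell_def eval_nat_numeral)
  have "y = x 2 (src (oriental 3) 2 ?a)" "y = x 2 (tgt (oriental 3) 2 ?a)"
    using omega_homD(2,3)[OF x a] y src_idn[OF y(1)] tgt_idn[OF y(1)] by simp_all
  then show "x 3 ?a = idn A 2 (x 2 (src (oriental 3) 2 ?a))"
    "x 2 (src (oriental 3) 2 ?a) = x 2 (tgt (oriental 3) 2 ?a)"
    using y(2) by (simp_all add: eval_nat_numeral)
qed

theorem nerve_3_eqI: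
  assumes A: "strict_omega_category A"
    and x: "x \<in> omega_hom (oriental 3) A" "trivial_principal A x"
    and x': "x' \<in> omega_hom (oriental 3) A" "trivial_principal A x'"
    and edges: "\<And>i j. i < j \<Longrightarrow> j \<le> 3 \<Longrightarrow> edge x i j = edge x' i j"
    and triangles: "\<And>i j k. i < j \<Longrightarrow> j < k \<Longrightarrow> k \<le> 3 \<Longrightarrow> triangle x i j k = triangle x' i j k"
  shows "x = x'"
proof -
  note E = edges[unfolded edge_def] and T = triangles[unfolded triangle_def]
  \<comment> \<open>Vertices are recovered as ends of edges; 3 is treated apart because no edge
    starts there.\<close>
  have V: "x 0 (atom [i]) = x' 0 (atom [i])" if "i \<le> 3" for i
  proof (cases "i < 3")
    case True
    have "atom [i, 3] \<in> cells (oriental 3) (Suc 0)" "src (oriental 3) 0 (atom [i, 3]) = atom [i]"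
      using True atom_cells(2)[of i 3 3] by (simp_all add: atom_2 atom_1 src_tab)
    then show ?thesis
      using omega_homD(2)[OF x(1), of "atom [i, 3]" 0] omega_homD(2)[OF x'(1), of "atom [i, 3]" 0]
        E[of i 3] True by simp
  next
    case False
    then have "i = 3" using that by simp
    have "atom [0, 3] \<in> cells (oriental 3) (Suc 0)" "tgt (oriental 3) 0 (atom [0, 3]) = atom [3]"
      using atom_cells(2)[of 0 3 3] by (simp_all add: atom_2 atom_1 tgt_tab)
    then show ?thesis
      using omega_homD(3)[OF x(1), of "atom [0, 3]" 0] omega_homD(3)[OF x'(1), of "atom [0, 3]" 0]
        E[of 0 3] \<open>i = 3\<close> by simp
  qed
  have c2: "x 2 c = x' 2 c" if "c \<in> cells (oriental 3) 2" for c
    using agree_2[OF x(1) x'(1) _ _ _ _ V E T] that by (elim cells_2_cases) simp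
  have "x k c = x' k c" if "c \<in> cells (oriental 3) k" for k c
    using that
  proof (induction k)
    case 0
    then show ?case using V by (elim cells_0_cases) simp
  next
    case (Suc k)
    consider "k = 0" | "k = 1" | "k = 2" | "3 \<le> k" by linarith
    then show ?case
    proof cases
      case 1
      then show ?thesis
        using Suc.prems agree_1[OF x(1) x'(1) _ V E]
        by (auto elim!: cells_1_cases[simplified])
    next
      case 2
      then show ?thesis
        using Suc.prems c2 by (simp add: numeral_2_eq_2)
    next
      case 3
      then have c: "c \<in> cells (oriental 3) 3" "Suc k = 3"
        using Suc.prems by (simp_all add: eval_nat_numeral)
      let ?s = "src (oriental 3) 2 (atom [0, 1, 2, 3])"
      have "?s \<in> cells (oriental 3) 2"
        using src_oriental_cell[of "atom [0, 1, 2, 3]" 3 2] atom_cells(4)[of 0 1 2 3 3]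
        by (simp add: eval_nat_numeral)
      then have "x 3 (atom [0, 1, 2, 3]) = x' 3 (atom [0, 1, 2, 3])"
        using trivial_principal_eq(1)[OF A x] trivial_principal_eq(1)[OF A x'] c2 by simp
      moreover have "x 3 c = x' 3 c" if "c \<in> cells (oriental 3) 2"
        using agree_idn[OF x(1) x'(1) that c2[OF that], of 3] by simp
      ultimately show ?thesis
        using principal_or_degenerate[OF c(1)] c(2) by metis
    next
      case 4
      \<comment> \<open>The vertices 0 to 3 admit no increasing tuple with more than four
        entries.\<close>
      have "c (Suc k) False = 0"
        using oriental_cellsD(1)[OF Suc.prems, of "Suc k" False] 4 pos_chains_eq_0[of 3 "Suc k"] by simp
      then have "c \<in> cells (oriental 3) k"
        using Suc.prems cells_pred by blast
      then show ?thesis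
        using Suc.IH agree_idn[OF x(1) x'(1), of c k "Suc k"] by simp
    qed
  qed
  moreover have "x k c = x' k c" if "c \<notin> cells (oriental 3) k" for k c
    using omega_homD(6)[OF x(1), of k] omega_homD(6)[OF x'(1), of k] that
    by (simp add: extensional_def)
  ultimately show ?thesis
    by (intro ext) blast
qed

section \<open>Whiskering with trivial cells\<close>

lemma iidn_same [simp]: "iidn C i i x = x"
  by (cases i) auto

context strict_omega_category
begin

lemma iidn_cell: "v \<in> cells C i \<Longrightarrow> i \<le> k \<Longrightarrow> iidn C i k v \<in> cells C k"
  by (induction k) (auto simp: le_Suc_eq idn_cell)

lemma isrc_iidn: "v \<in> cells C i \<Longrightarrow> i \<le> k \<Longrightarrow> isrc C i k (iidn C i k v) = v"
  by (induction k) (auto simp: le_Suc_eq src_idn iidn_cell)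

lemma itgt_iidn: "v \<in> cells C i \<Longrightarrow> i \<le> k \<Longrightarrow> itgt C i k (iidn C i k v) = v"
  by (induction k) (auto simp: le_Suc_eq tgt_idn iidn_cell)

lemma cmp_iidn_left:
  assumes "composable C i k (iidn C i k v) x" "v \<in> cells C i"
  shows "cmp C i k (iidn C i k v) x = x"
  using assms cmp_unit_tgt[of x k i] isrc_iidn[of v i k] by (auto simp: composable_def)

lemma cmp_iidn_right:
  assumes "composable C i k x (iidn C i k v)" "v \<in> cells C i"
  shows "cmp C i k x (iidn C i k v) = x"
  using assms cmp_unit_src[of x k i] itgt_iidn[of v i k] by (auto simp: composable_def)

text \<open>For \<open>i < k\<close> this is \<open>idn_cmp\<close>; for \<open>i = k\<close> that
  law does not apply and the unit law takes its place.\<close>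

lemma trivial_cell_cmp:
  assumes comp: "composable C i (Suc k) y x" and "trivial_cell C k x" "trivial_cell C k y"
  shows "trivial_cell C k (cmp C i (Suc k) y x)"
proof -
  obtain u v where uv: "u \<in> cells C k" "x = idn C k u" "v \<in> cells C k" "y = idn C k v"
    using assms(2,3) by (auto simp: trivial_cell_def)
  show ?thesis
  proof (cases "i = k")
    case True
    then show ?thesis
      using comp assms(2) uv cmp_iidn_left[of k "Suc k" v x] by simp
  next
    case False
    then have "composable C i k v u"
      using comp uv by (auto simp: composable_def src_idn tgt_idn less_Suc_eq)
    then show ?thesis
      using idn_cmp cmp_cell uv unfolding trivial_cell_def by metis
  qed
qed

lemma cmp_trivial_left:
  assumes "composable C k (Suc k) y x" "trivial_cell C k y"
  shows "cmp C k (Suc k) y x = x"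
proof -
  obtain v where "v \<in> cells C k" "y = idn C k v"
    using assms(2) by (auto simp: trivial_cell_def)
  then show ?thesis
    using assms(1) cmp_iidn_left[of k "Suc k" v x] by simp
qed

end

lemma iidn_numeral:
  "iidn C 0 (Suc 0) x = idn C 0 x"
  "iidn C 0 2 x = idn C 1 (idn C 0 x)"
  "iidn C 0 3 x = idn C 2 (idn C 1 (idn C 0 x))"
  "iidn C (Suc 0) 2 x = idn C 1 x"
  "iidn C (Suc 0) 3 x = idn C 2 (idn C 1 x)"
  by (simp_all add: numeral_3_eq_3 numeral_2_eq_2)

section \<open>Images of composable cells and of identities under a functor\<close>

lemma hom_itgt:
  assumes "x \<in> omega_hom (oriental n) A" "c \<in> cells (oriental n) k" "i \<le> k"
  shows "itgt A i k (x k c) = x i (itgt (oriental n) i k c)"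
  using assms(2,3)
proof (induction k arbitrary: c)
  case (Suc k)
  then show ?case
    using omega_homD(3)[OF assms(1) Suc.prems(1)] tgt_oriental_cell[OF Suc.prems(1)]
    by (auto simp: le_Suc_eq)
qed simp

lemma hom_isrc:
  assumes "x \<in> omega_hom (oriental n) A" "c \<in> cells (oriental n) k" "i \<le> k"
  shows "isrc A i k (x k c) = x i (isrc (oriental n) i k c)"
  using assms(2,3)
proof (induction k arbitrary: c)
  case (Suc k)
  then show ?case
    using omega_homD(2)[OF assms(1) Suc.prems(1)] src_oriental_cell[OF Suc.prems(1)]
    by (auto simp: le_Suc_eq)
qed simp

lemma hom_composable:
  assumes "x \<in> omega_hom (oriental n) A" "composable (oriental n) i k d c"
  shows "composable A i k (x k d) (x k c)"
  using assms hom_itgt[OF assms(1), of c k i] hom_isrc[OF assms(1), of d k i]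
    omega_homD(1)[OF assms(1)]
  by (auto simp: composable_def)

lemma hom_trivial:
  assumes "x \<in> omega_hom (oriental n) A" "c \<in> cells (oriental n) k"
  shows "trivial_cell A k (x (Suc k) c)"
  using hom_idn[OF assms] omega_homD(1)[OF assms] by (auto simp: trivial_cell_def)

lemmas composable_tab = composable_oriental tab_in_cells src_tab tgt_tab
lemmas atom_tab = atom_1 atom_2 atom_3 atom_4

lemma hom_whisker_idn:
  assumes x: "x \<in> omega_hom (oriental n) A" and c: "c \<in> cells (oriental n) 1"
  shows "x 2 c = idn A 1 (x 1 c)" "x 3 c = idn A 2 (idn A 1 (x 1 c))"
  using hom_idn[OF x c] hom_idn[OF x cells_mono[OF _ c], of 2] by (simp_all add: eval_nat_numeral)

section \<open>Sources and targets of edges and triangles\<close>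

context
  fixes A :: "'a ocat" and n and x :: "nat \<Rightarrow> table \<Rightarrow> 'a"
  assumes x: "x \<in> omega_hom (oriental n) A"
begin

lemma vertex_cell: "i \<le> n \<Longrightarrow> x 0 (atom [i]) \<in> cells A 0"
  using omega_homD(1)[OF x] atom_cells by blast

lemma edge_arrow: "i < j \<Longrightarrow> j \<le> n \<Longrightarrow> arrow A 0 (edge x i j) (x 0 (atom [i])) (x 0 (atom [j]))"
  using omega_homD(1-3)[OF x, of "atom [i, j]"] atom_cells(2)[of i j n]
  by (auto simp: arrow_def edge_def) (simp_all add: atom_tab src_tab tgt_tab)

lemma triangle_arrow:
  assumes "i < j" "j < k" "k \<le> n"
  shows "arrow A 1 (triangle x i j k) (edge x i k) (cmp A 0 1 (edge x j k) (edge x i j))"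
proof -
  have a: "atom [i, j, k] \<in> cells (oriental n) (Suc 1)"
    using atom_cells(3)[OF assms] by (simp add: numeral_2_eq_2)
  have comp: "composable (oriental n) 0 1 (atom [j, k]) (atom [i, j])"
    using assms by (simp add: atom_tab composable_tab)
  have "src (oriental n) 1 (atom [i, j, k]) = atom [i, k]"
    "tgt (oriental n) 1 (atom [i, j, k]) = cmp (oriental n) 0 1 (atom [j, k]) (atom [i, j])"
    using assms by (simp_all add: atom_tab src_tab tgt_tab cmp_tab add.commute)
  then show ?thesis
    using omega_homD(1-3)[OF x a] omega_homD(5)[OF x comp]
    by (simp add: arrow_def edge_def triangle_def numeral_2_eq_2)
qed

end

text \<open>The two sides are the source and the target of the principal cell. Composability is
  recorded along with the equation, because the unit laws that later simplify either side require
  it.\<close>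

lemma trivial_principal_imp_eq:
  assumes A: "strict_omega_category A" and x: "x \<in> omega_hom (oriental 3) A" "trivial_principal A x"
  shows "cmp A 1 2 (cmp A 0 2 (idn A 1 (edge x 2 3)) (triangle x 0 1 2)) (triangle x 0 2 3)
    = cmp A 1 2 (cmp A 0 2 (triangle x 1 2 3) (idn A 1 (edge x 0 1))) (triangle x 0 1 3)"
    (is "?l = ?r")
    and "composable A 1 2 (cmp A 0 2 (idn A 1 (edge x 2 3)) (triangle x 0 1 2)) (triangle x 0 2 3)"
    and "composable A 1 2 (cmp A 0 2 (triangle x 1 2 3) (idn A 1 (edge x 0 1))) (triangle x 0 1 3)"
    and "composable A 0 2 (idn A 1 (edge x 2 3)) (triangle x 0 1 2)"
    and "composable A 0 2 (triangle x 1 2 3) (idn A 1 (edge x 0 1))"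
proof -
  let ?O = "oriental 3"
  let ?L = "cmp ?O 0 2 (atom [2, 3]) (atom [0, 1, 2])"
  let ?R = "cmp ?O 0 2 (atom [1, 2, 3]) (atom [0, 1])"
  have L: "composable ?O 0 2 (atom [2, 3]) (atom [0, 1, 2])"
    and L': "composable ?O 1 2 ?L (atom [0, 2, 3])"
    and R: "composable ?O 0 2 (atom [1, 2, 3]) (atom [0, 1])"
    and R': "composable ?O 1 2 ?R (atom [0, 1, 3])"
    by (simp_all add: atom_tab cmp_tab composable_tab pos_chains.plus algebra_simps)
  have "src ?O 2 (atom [0, 1, 2, 3]) = cmp ?O 1 2 ?L (atom [0, 2, 3])"
    "tgt ?O 2 (atom [0, 1, 2, 3]) = cmp ?O 1 2 ?R (atom [0, 1, 3])"
    by (simp_all add: atom_tab cmp_tab src_tab tgt_tab algebra_simps)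
  then have "x 2 (cmp ?O 1 2 ?L (atom [0, 2, 3])) = x 2 (cmp ?O 1 2 ?R (atom [0, 1, 3]))"
    using trivial_principal_eq(2)[OF A x] by simp
  moreover have "x 2 (atom [0, 1]) = idn A 1 (edge x 0 1)" "x 2 (atom [2, 3]) = idn A 1 (edge x 2 3)"
    unfolding edge_def by (rule hom_whisker_idn[OF x(1)], simp add: atom_tab tab_in_cells)+
  ultimately show "?l = ?r"
    "composable A 1 2 (cmp A 0 2 (idn A 1 (edge x 2 3)) (triangle x 0 1 2)) (triangle x 0 2 3)"
    "composable A 1 2 (cmp A 0 2 (triangle x 1 2 3) (idn A 1 (edge x 0 1))) (triangle x 0 1 3)"
    "composable A 0 2 (idn A 1 (edge x 2 3)) (triangle x 0 1 2)"
    "composable A 0 2 (triangle x 1 2 3) (idn A 1 (edge x 0 1))"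
    using omega_homD(5)[OF x(1) L] omega_homD(5)[OF x(1) L'] omega_homD(5)[OF x(1) R]
      omega_homD(5)[OF x(1) R'] hom_composable[OF x(1) L] hom_composable[OF x(1) L']
      hom_composable[OF x(1) R] hom_composable[OF x(1) R']
    by (simp_all add: triangle_def)
qed

section \<open>The principal cells of the faces of a 4-simplex\<close>

text \<open>Produces a 4-cell directly from its top chain \<open>w\<close>, which spares evaluating
  the iterated positive and negative parts of an atom on five vertices.\<close>

lemma cell_between:
  assumes a: "tab s0 t0 s1 t1 s2 t2 a \<in> cells (oriental n) 3"
    and b: "tab s0 t0 s1 t1 s2 t2 b \<in> cells (oriental n) 3"
    and w: "w \<in> pos_chains n 4" "bdry w = b - a"
  obtains W where "W \<in> cells (oriental n) (Suc 3)" "src (oriental n) 3 W = tab s0 t0 s1 t1 s2 t2 a"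
    "tgt (oriental n) 3 W = tab s0 t0 s1 t1 s2 t2 b"
proof
  let ?W = "\<lambda>p \<epsilon>. if p = 4 then w else if p = 3 then (if \<epsilon> then b else a) else tab s0 t0 s1 t1 s2 t2 0 p \<epsilon>"
  note aD = a[unfolded tab_in_cells_3] and bD = b[unfolded tab_in_cells_3]
  show "?W \<in> cells (oriental n) (Suc 3)"
  proof (rule oriental_cellsI)
    show "?W p \<epsilon> \<in> pos_chains n p" if p: "p \<le> Suc 3" for p \<epsilon>
    proof -
      consider "p = 0" | "p = 1" | "p = 2" | "p = 3" | "p = 4" using p by linarith
      then show ?thesis using aD bD w(1) by cases (auto simp: tab_def)
    qed
    show "bdry (?W (Suc p) \<epsilon>) = ?W p True - ?W p False" if "p < Suc 3" for p \<epsilon>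
      using that aD bD w(2) by (auto simp: less_Suc_eq less_3_nat tab_def)
  qed (use aD in \<open>auto simp: tab_def\<close>)
  show "src (oriental n) 3 ?W = tab s0 t0 s1 t1 s2 t2 a" "tgt (oriental n) 3 ?W = tab s0 t0 s1 t1 s2 t2 b"
    by (auto simp: oriental_simps tab_def fun_eq_iff)
qed

lemma trivial_face_0123:
  assumes A: "strict_3_category A" and x: "x \<in> omega_hom (oriental 4) A"
    and faces: "trivial_cell A 2 (x 3 (atom [1, 2, 3, 4]))" "trivial_cell A 2 (x 3 (atom [0, 2, 3, 4]))"
      "trivial_cell A 2 (x 3 (atom [0, 1, 3, 4]))" "trivial_cell A 2 (x 3 (atom [0, 1, 2, 4]))"
    and edge: "v \<in> cells A 0" "edge x 3 4 = idn A 0 v"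
    and triangle: "f \<in> cells A 1" "triangle x 0 3 4 = idn A 1 f"
  shows "trivial_cell A 2 (x 3 (atom [0, 1, 2, 3]))"
proof -
  interpret strict_3_category A by (rule A)
  let ?O = "oriental 4"
  let ?v0 = "frag_of [0]" and ?v4 = "frag_of [4]" and ?p = "frag_of [0, 1] + frag_of [1, 2] + frag_of [2, 3] + frag_of [3, 4]"
  \<comment> \<open>The triangles 012, 234 and 123, whiskered so as to run from vertex 0 to vertex
    4. They are composed with 3-cells as their own identities.\<close>
  define w1 where "w1 = tab2 ?v0 ?v4 (frag_of [0, 2] + frag_of [2, 3] + frag_of [3, 4]) ?p (frag_of [0, 1, 2])"
  define w2 where "w2 = tab2 ?v0 ?v4 (frag_of [0, 1] + frag_of [1, 2] + frag_of [2, 4]) ?p (frag_of [2, 3, 4])"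
  define w3 where "w3 = tab2 ?v0 ?v4 (frag_of [0, 1] + frag_of [1, 3] + frag_of [3, 4]) ?p (frag_of [1, 2, 3])"
  have w: "w1 \<in> cells ?O 2" "w2 \<in> cells ?O 2" "w3 \<in> cells ?O 2"
    unfolding w1_def w2_def w3_def
    by (simp_all add: tab_in_cells pos_chains.plus)
  let ?q1 = "cmp ?O 1 3 w1 (atom [0, 2, 3, 4])" and ?q2 = "cmp ?O 1 3 w2 (atom [0, 1, 2, 4])"
  let ?a = "cmp ?O 0 3 (atom [3, 4]) (atom [0, 1, 2, 3])"
  let ?p1 = "cmp ?O 1 3 ?a (atom [0, 3, 4])" and ?p2 = "cmp ?O 1 3 w3 (atom [0, 1, 3, 4])"
  let ?b = "cmp ?O 0 3 (atom [1, 2, 3, 4]) (atom [0, 1])"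
  let ?p3 = "cmp ?O 1 3 ?b (atom [0, 1, 4])"
  \<comment> \<open>The two sides of the principal 4-cell: \<open>?S\<close> passes through 0234 and
    then 0124, the faces of negative sign, and \<open>?T\<close> through 0123, 0134 and 1234, those
    of positive sign.\<close>
  let ?S = "cmp ?O 2 3 ?q2 ?q1" and ?T = "cmp ?O 2 3 ?p3 (cmp ?O 2 3 ?p2 ?p1)"
  note simps = atom_tab cmp_tab composable_tab pos_chains.plus w1_def w2_def w3_def algebra_simps
  have q1: "composable ?O 1 3 w1 (atom [0, 2, 3, 4])" by (simp add: simps)
  have q2: "composable ?O 1 3 w2 (atom [0, 1, 2, 4])" by (simp add: simps)
  have a: "composable ?O 0 3 (atom [3, 4]) (atom [0, 1, 2, 3])" by (simp add: simps)
  have p1: "composable ?O 1 3 ?a (atom [0, 3, 4])" by (simp add: simps)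
  have p2: "composable ?O 1 3 w3 (atom [0, 1, 3, 4])" by (simp add: simps)
  have b: "composable ?O 0 3 (atom [1, 2, 3, 4]) (atom [0, 1])" by (simp add: simps)
  have p3: "composable ?O 1 3 ?b (atom [0, 1, 4])" by (simp add: simps)
  have S: "composable ?O 2 3 ?q2 ?q1" by (simp add: simps)
  have T1: "composable ?O 2 3 ?p2 ?p1" by (simp add: simps)
  have T: "composable ?O 2 3 ?p3 (cmp ?O 2 3 ?p2 ?p1)" by (simp add: simps)
  let ?s2 = "frag_of [0, 1, 2] + frag_of [0, 2, 3] + frag_of [0, 3, 4]"
    and ?t2 = "frag_of [2, 3, 4] + frag_of [1, 2, 4] + frag_of [0, 1, 4]"
    and ?s3 = "frag_of [0, 1, 2, 4] + frag_of [0, 2, 3, 4]"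
    and ?t3 = "frag_of [1, 2, 3, 4] + frag_of [0, 1, 3, 4] + frag_of [0, 1, 2, 3]"
  have S_eq: "?S = tab ?v0 ?v4 (frag_of [0, 4]) ?p ?s2 ?t2 ?s3"
    and T_eq: "?T = tab ?v0 ?v4 (frag_of [0, 4]) ?p ?s2 ?t2 ?t3"
    by (simp_all add: simps)
  obtain W where W: "W \<in> cells ?O (Suc 3)" "src ?O 3 W = ?S" "tgt ?O 3 W = ?T"
  proof (rule cell_between)
    show "tab ?v0 ?v4 (frag_of [0, 4]) ?p ?s2 ?t2 ?s3 \<in> cells ?O 3"
      "tab ?v0 ?v4 (frag_of [0, 4]) ?p ?s2 ?t2 ?t3 \<in> cells ?O 3"
      using cmp_oriental_cell[OF S] cmp_oriental_cell[OF T] unfolding S_eq T_eq .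
    show "frag_of [0, 1, 2, 3, 4] \<in> pos_chains 4 4"
      by (simp add: tuples_def)
    show "bdry (frag_of [0, 1, 2, 3, 4]) = ?t3 - ?s3"
      by simp
  qed (simp only: S_eq T_eq that)
  \<comment> \<open>This is where dimension 3 enters: the image of the 4-cell is an identity, so
    \<open>?S\<close> and \<open>?T\<close> have the same image.\<close>
  obtain y where y: "y \<in> cells A 3" "x (Suc 3) W = idn A 3 y"
    using trivial_above_3[OF _ omega_homD(1)[OF x W(1)]] by (auto simp: trivial_cell_def)
  have "x 3 ?S = x 3 ?T"
    using omega_homD(2,3)[OF x W(1)] y src_idn[OF y(1)] tgt_idn[OF y(1)] W(2,3) by simp
  have triv: "trivial_cell A 2 (x 3 c)" if "c \<in> cells ?O 2" for c
    using hom_trivial[OF x that] by (simp add: eval_nat_numeral)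
  have triv_cmp: "trivial_cell A 2 (x 3 (cmp ?O i 3 d c))"
    if "composable ?O i 3 d c" "trivial_cell A 2 (x 3 c)" "trivial_cell A 2 (x 3 d)" for i c d
    using trivial_cell_cmp[of i 2 "x 3 d" "x 3 c"] hom_composable[OF x that(1)] that(2,3)
      omega_homD(5)[OF x that(1)] by (simp add: eval_nat_numeral)
  have drop: "x 3 (cmp ?O 2 3 d c) = x 3 c"
    if "composable ?O 2 3 d c" "trivial_cell A 2 (x 3 d)" for c d
    using cmp_trivial_left[of 2 "x 3 d" "x 3 c"] hom_composable[OF x that(1)] that(2)
      omega_homD(5)[OF x that(1)] by (simp add: eval_nat_numeral)
  have cells2: "atom [0, 1] \<in> cells ?O 2" "atom [0, 1, 4] \<in> cells ?O 2"
    by (simp_all add: atom_tab tab_in_cells pos_chains.plus)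
  have "trivial_cell A 2 (x 3 ?S)"
    by (rule triv_cmp[OF S triv_cmp[OF q1 faces(2) triv[OF w(1)]] triv_cmp[OF q2 faces(4) triv[OF w(2)]]])
  moreover have "trivial_cell A 2 (x 3 ?p2)"
    by (rule triv_cmp[OF p2 faces(3) triv[OF w(3)]])
  moreover have "trivial_cell A 2 (x 3 ?p3)"
    by (rule triv_cmp[OF p3 triv[OF cells2(2)] triv_cmp[OF b triv[OF cells2(1)] faces(1)]])
  \<comment> \<open>The later factors \<open>?p3\<close> and \<open>?p2\<close> of \<open>?T\<close>
    have trivial images and drop out, so \<open>?p1\<close> has the same image as
    \<open>?S\<close>.\<close>
  ultimately have "trivial_cell A 2 (x 3 ?p1)"
    using drop[OF T] drop[OF T1] \<open>x 3 ?S = x 3 ?T\<close> by simp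
  moreover have "x 3 ?p1 = x 3 ?a"
  proof -
    have "x 3 (atom [0, 3, 4]) = iidn A 1 3 f"
      using hom_idn[OF x, of "atom [0, 3, 4]" 2] triangle(2)
      by (simp add: triangle_def iidn_numeral atom_cells)
    then show ?thesis
      using hom_composable[OF x p1] omega_homD(5)[OF x p1] cmp_iidn_right triangle(1) by metis
  qed
  moreover have "x 3 ?a = x 3 (atom [0, 1, 2, 3])"
  proof -
    have "x 3 (atom [3, 4]) = iidn A 0 3 v"
      using hom_whisker_idn(2)[OF x, of "atom [3, 4]"] edge(2)
      by (simp add: edge_def iidn_numeral atom_cells[simplified])
    then show ?thesis
      using hom_composable[OF x a] omega_homD(5)[OF x a] cmp_iidn_left edge(1) by metis
  qed
  ultimately show ?thesis by simp
qed

section \<open>Degenerate edges and triangles\<close>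

text \<open>The value for \<open>i = j\<close> is the edge of a degenerate face. With it, pulling
  back along a vertex map obeys one formula, \<open>pull_dedge\<close>, whether or not vertices are
  repeated.\<close>

definition dedge :: "'a ocat \<Rightarrow> (nat \<Rightarrow> table \<Rightarrow> 'a) \<Rightarrow> nat \<Rightarrow> nat \<Rightarrow> 'a" where
  "dedge A x i j = (if i < j then edge x i j else idn A 0 (x 0 (atom [i])))"

definition dtriangle :: "'a ocat \<Rightarrow> (nat \<Rightarrow> table \<Rightarrow> 'a) \<Rightarrow> nat \<Rightarrow> nat \<Rightarrow> nat \<Rightarrow> 'a" where
  "dtriangle A x i j k = (if i < j \<and> j < k then triangle x i j k else idn A 1 (dedge A x i k))"

text \<open>Equality of two possibly degenerate 2-dimensional faces, spelled out in their cells;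
  \<open>morphism_same_face\<close> shows that morphisms of nerves preserve it.\<close>

definition same_face :: "'a ocat \<Rightarrow> (nat \<Rightarrow> table \<Rightarrow> 'a) \<Rightarrow> nat \<times> nat \<times> nat \<Rightarrow> nat \<times> nat \<times> nat \<Rightarrow> bool" where
  "same_face A x = (\<lambda>(i, j, k) (i', j', k').
     dedge A x i j = dedge A x i' j' \<and> dedge A x j k = dedge A x j' k' \<and>
     dedge A x i k = dedge A x i' k' \<and> dtriangle A x i j k = dtriangle A x i' j' k')"

text \<open>A tuple with a repetition counts as zero, as a degenerate simplex does in normalized
  chains.\<close>

definition tuple_chain :: "nat list \<Rightarrow> chain" where
  "tuple_chain \<sigma> = (if sorted_wrt (<) \<sigma> then frag_of \<sigma> else 0)"

lemma dedge_eq: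
  assumes x: "x \<in> omega_hom (oriental n) A" and "i \<le> j" "j \<le> n"
  shows "dedge A x i j = x 1 (tab1 (frag_of [i]) (frag_of [j]) (tuple_chain [i, j]))"
    and "tab1 (frag_of [i]) (frag_of [j]) (tuple_chain [i, j]) \<in> cells (oriental n) 1"
proof -
  show "dedge A x i j = x 1 (tab1 (frag_of [i]) (frag_of [j]) (tuple_chain [i, j]))"
    using assms hom_idn[OF x atom_cells(1)[of i n]]
    by (cases "i < j") (auto simp: dedge_def edge_def tuple_chain_def atom_tab)
  show "tab1 (frag_of [i]) (frag_of [j]) (tuple_chain [i, j]) \<in> cells (oriental n) 1"
    using assms by (auto simp: tuple_chain_def tab_in_cells)
qed

lemma dtriangle_eq:
  assumes x: "x \<in> omega_hom (oriental n) A" and "i \<le> j" "j \<le> k" "k \<le> n"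
  shows "dtriangle A x i j k = x 2 (tab2 (frag_of [i]) (frag_of [k]) (tuple_chain [i, k])
      (tuple_chain [i, j] + tuple_chain [j, k]) (tuple_chain [i, j, k]))"
    and "tab2 (frag_of [i]) (frag_of [k]) (tuple_chain [i, k])
      (tuple_chain [i, j] + tuple_chain [j, k]) (tuple_chain [i, j, k]) \<in> cells (oriental n) 2"
proof -
  show "dtriangle A x i j k = x 2 (tab2 (frag_of [i]) (frag_of [k]) (tuple_chain [i, k])
      (tuple_chain [i, j] + tuple_chain [j, k]) (tuple_chain [i, j, k]))"
  proof (cases "i < j \<and> j < k")
    case True
    then show ?thesis
      by (simp add: dtriangle_def triangle_def tuple_chain_def atom_tab)
  next
    case False
    then have "i = j \<or> j = k" using assms by auto
    then have "tuple_chain [i, k] = tuple_chain [i, j] + tuple_chain [j, k]" "tuple_chain [i, j, k] = 0"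
      by (auto simp: tuple_chain_def)
    then show ?thesis
      using False assms dedge_eq[OF x, of i k] hom_whisker_idn(1)[OF x dedge_eq(2)[OF x, of i k]]
      by (auto simp: dtriangle_def)
  qed
  show "tab2 (frag_of [i]) (frag_of [k]) (tuple_chain [i, k])
      (tuple_chain [i, j] + tuple_chain [j, k]) (tuple_chain [i, j, k]) \<in> cells (oriental n) 2"
    using assms by (auto simp: tuple_chain_def tab_in_cells pos_chains.plus)
qed

context
  fixes A :: "'a ocat" and m n and g and x :: "nat \<Rightarrow> table \<Rightarrow> 'a"
  assumes x: "x \<in> omega_hom (oriental n) A" and g: "directed_map m n g"
    and van: "\<And>\<sigma>. \<not> distinct \<sigma> \<Longrightarrow> g \<sigma> = 0"
begin

text \<open>The predicate \<open>directed_map\<close> constrains \<open>g\<close> on strictly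
  increasing tuples only; \<open>van\<close> makes it vanish on repetitions, so degenerate edges and
  triangles follow the general formula.\<close>

lemma frag_extend_tuple_chain: "sorted \<sigma> \<Longrightarrow> frag_extend g (tuple_chain \<sigma>) = g \<sigma>"
  using van[of \<sigma>] by (auto simp: tuple_chain_def strict_sorted_iff)

lemma pullback_dedge:
  assumes "i \<le> j" "j \<le> m"
  shows "dedge A (pullback m g x) i j = x 1 (tab1 (g [i]) (g [j]) (g [i, j]))"
  using dedge_eq[OF pullback_hom[OF g x] assms] assms
  by (simp add: pullback_apply lift_tab frag_extend_tuple_chain)

lemma pullback_dtriangle:
  assumes "i \<le> j" "j \<le> k" "k \<le> m"
  shows "dtriangle A (pullback m g x) i j k =
    x 2 (tab2 (g [i]) (g [k]) (g [i, k]) (g [i, j] + g [j, k]) (g [i, j, k]))"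
  using dtriangle_eq[OF pullback_hom[OF g x] assms] assms
  by (simp add: pullback_apply lift_tab frag_extend_tuple_chain frag_extend_add)

lemma pullback_principal:
  assumes "m = 3" "g [0, 1, 2, 3] = 0"
  shows "trivial_principal A (pullback 3 g x)"
proof -
  have a: "atom [0, 1, 2, 3] \<in> cells (oriental 3) 3"
    by (simp add: atom_cells)
  have "lift g (atom [0, 1, 2, 3]) \<in> cells (oriental n) 3"
    using lift_cell[OF g] a assms(1) by blast
  moreover have "lift g (atom [0, 1, 2, 3]) 3 False = 0"
    using assms(2) by (simp add: atom_4 lift_def tab_def)
  ultimately have "lift g (atom [0, 1, 2, 3]) \<in> cells (oriental n) 2"
    using cells_pred[of _ n 2] by (simp add: eval_nat_numeral)
  then show ?thesis
    using hom_trivial[OF x] a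
    by (simp add: trivial_principal_def pullback_apply) (simp add: eval_nat_numeral)
qed

end

lemma simplex_map_nth:
  "a \<le> b \<Longrightarrow> b \<le> c \<Longrightarrow> c \<le> d \<Longrightarrow> d \<le> n \<Longrightarrow> simplex_map 3 n ((!) [a, b, c, d])"
  by (auto simp: simplex_map_def mono_on_def le_3_nat)

lemma tuple_map_not_distinct: "\<not> distinct \<sigma> \<Longrightarrow> tuple_map \<theta> \<sigma> = 0"
  by (auto simp: tuple_map_def strict_sorted_iff distinct_map)

lemma simplex_mapD:
  assumes "simplex_map m n \<theta>"
  shows "i \<le> j \<Longrightarrow> j \<le> m \<Longrightarrow> \<theta> i \<le> \<theta> j" "j \<le> m \<Longrightarrow> \<theta> j \<le> n"
  using assms by (auto simp: simplex_map_def mono_on_def)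

context
  fixes A :: "'a ocat" and n \<theta> and x :: "nat \<Rightarrow> table \<Rightarrow> 'a"
  assumes x: "x \<in> omega_hom (oriental n) A" and \<theta>: "simplex_map 3 n \<theta>"
begin

lemma pull_hom: "pull (street_nerve A) 3 n \<theta> x \<in> omega_hom (oriental 3) A"
  unfolding street_nerve_simps by (rule pullback_hom[OF directed_map_tuple_map[OF \<theta>] x])

lemma pull_dedge:
  assumes "i \<le> j" "j \<le> 3"
  shows "dedge A (pull (street_nerve A) 3 n \<theta> x) i j = dedge A x (\<theta> i) (\<theta> j)"
  using pullback_dedge[OF x directed_map_tuple_map[OF \<theta>] tuple_map_not_distinct assms]
    dedge_eq(1)[OF x, of "\<theta> i" "\<theta> j"] simplex_mapD[OF \<theta>] assms
  by (simp add: street_nerve_simps) (simp add: tuple_map_def tuple_chain_def)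

lemma pull_dtriangle:
  assumes "i \<le> j" "j \<le> k" "k \<le> 3"
  shows "dtriangle A (pull (street_nerve A) 3 n \<theta> x) i j k = dtriangle A x (\<theta> i) (\<theta> j) (\<theta> k)"
  using pullback_dtriangle[OF x directed_map_tuple_map[OF \<theta>] tuple_map_not_distinct assms]
    dtriangle_eq(1)[OF x, of "\<theta> i" "\<theta> j" "\<theta> k"] simplex_mapD[OF \<theta>] assms
  by (simp add: street_nerve_simps) (simp add: tuple_map_def tuple_chain_def)

lemma pull_principal:
  assumes "\<not> sorted_wrt (<) [\<theta> 0, \<theta> 1, \<theta> 2, \<theta> 3]"
  shows "trivial_principal A (pull (street_nerve A) 3 n \<theta> x)"
  unfolding street_nerve_simps
  by (rule pullback_principal[OF x directed_map_tuple_map[OF \<theta>] tuple_map_not_distinct])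
    (use assms in \<open>auto simp: tuple_map_def\<close>)

lemma pull_principal_face:
  assumes "sorted_wrt (<) [\<theta> 0, \<theta> 1, \<theta> 2, \<theta> 3]"
  shows "trivial_principal A (pull (street_nerve A) 3 n \<theta> x) \<longleftrightarrow>
    trivial_cell A 2 (x 3 (atom [\<theta> 0, \<theta> 1, \<theta> 2, \<theta> 3]))"
proof -
  have "lift (tuple_map \<theta>) (atom [0, 1, 2, 3]) = atom [\<theta> 0, \<theta> 1, \<theta> 2, \<theta> 3]"
    using assms by (simp add: atom_4 lift_tab frag_extend_add tuple_map_def)
  then show ?thesis
    by (simp add: trivial_principal_def street_nerve_simps pullback_apply atom_cells)
qed

lemma pull_same_face:
  assumes "i \<le> j" "j \<le> k" "k \<le> 3" "i' \<le> j'" "j' \<le> k'" "k' \<le> 3"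
  shows "same_face A (pull (street_nerve A) 3 n \<theta> x) (i, j, k) (i', j', k') \<longleftrightarrow>
    same_face A x (\<theta> i, \<theta> j, \<theta> k) (\<theta> i', \<theta> j', \<theta> k')"
  using assms by (simp add: same_face_def pull_dedge pull_dtriangle)

end

lemma nerve_3_eqI_dedge:
  assumes A: "strict_omega_category A"
    and x: "x \<in> omega_hom (oriental 3) A" "trivial_principal A x"
    and x': "x' \<in> omega_hom (oriental 3) A" "trivial_principal A x'"
    and "dedge A x 0 1 = dedge A x' 0 1" "dedge A x 0 2 = dedge A x' 0 2" "dedge A x 0 3 = dedge A x' 0 3"
      "dedge A x 1 2 = dedge A x' 1 2" "dedge A x 1 3 = dedge A x' 1 3" "dedge A x 2 3 = dedge A x' 2 3"
      "dtriangle A x 0 1 2 = dtriangle A x' 0 1 2" "dtriangle A x 0 1 3 = dtriangle A x' 0 1 3"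
      "dtriangle A x 0 2 3 = dtriangle A x' 0 2 3" "dtriangle A x 1 2 3 = dtriangle A x' 1 2 3"
  shows "x = x'"
proof (rule nerve_3_eqI[OF A x x'])
  have small: "k \<le> 3 \<Longrightarrow> k = 0 \<or> k = 1 \<or> k = 2 \<or> k = 3" for k :: nat
    using le_3_nat by blast
  show "edge x i j = edge x' i j" if ij: "i < j" "j \<le> 3" for i j
  proof -
    have "dedge A x i j = dedge A x' i j"
      using small[of i] small[of j] ij assms(6-11) by auto
    then show ?thesis using ij by (simp add: dedge_def)
  qed
  show "triangle x i j k = triangle x' i j k" if ijk: "i < j" "j < k" "k \<le> 3" for i j k
  proof -
    have "dtriangle A x i j k = dtriangle A x' i j k"
      using small[of i] small[of j] small[of k] ijk assms(12-15) by auto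
    then show ?thesis using ijk by (simp add: dtriangle_def)
  qed
qed

lemma dedge_tgt:
  assumes "strict_omega_category A" and x: "x \<in> omega_hom (oriental n) A" and "i \<le> j" "j \<le> n"
  shows "src A 0 (dedge A x i j) = x 0 (atom [i])" "tgt A 0 (dedge A x i j) = x 0 (atom [j])"
proof -
  interpret strict_omega_category A by fact
  show "src A 0 (dedge A x i j) = x 0 (atom [i])" "tgt A 0 (dedge A x i j) = x 0 (atom [j])"
    using assms edge_arrow[OF x, of i j] src_idn[OF vertex_cell[OF x, of i]] tgt_idn[OF vertex_cell[OF x, of i]]
    by (auto simp: dedge_def arrow_def)
qed

lemma morphism_same_face:
  assumes A: "strict_omega_category A" and F: "sset_morphism (street_nerve A) (street_nerve B) F"
    and x: "x \<in> omega_hom (oriental n) A"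
    and same: "same_face A x (i, j, k) (i', j', k')"
    and le: "i \<le> j" "j \<le> k" "k \<le> n" "i' \<le> j'" "j' \<le> k'" "k' \<le> n"
  shows "same_face B (F n x) (i, j, k) (i', j', k')"
proof -
  \<comment> \<open>Extensionality is available for 3-simplices with trivial principal cell;
    repeating the last vertex turns each face into such a simplex.\<close>
  let ?\<theta> = "(!) [i, j, k, k]" and ?\<theta>' = "(!) [i', j', k', k']"
  have \<theta>: "simplex_map 3 n ?\<theta>" "simplex_map 3 n ?\<theta>'"
    using le by (auto intro!: simplex_map_nth)
  have Fx: "F n x \<in> omega_hom (oriental n) B"
    using F x by (simp add: sset_morphism_def street_nerve_simps)
  \<comment> \<open>The padded simplices contain the identity of their last vertex as edge 23, so
    these vertices must agree as well.\<close>
  have "x 0 (atom [k]) = x 0 (atom [k'])"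
    using dedge_tgt(2)[OF A x, of i k] dedge_tgt(2)[OF A x, of i' k'] same le
    by (simp add: same_face_def)
  then have "pull (street_nerve A) 3 n ?\<theta> x = pull (street_nerve A) 3 n ?\<theta>' x"
    using same
    by (intro nerve_3_eqI_dedge[OF A pull_hom[OF x \<theta>(1)] pull_principal[OF x \<theta>(1)]
          pull_hom[OF x \<theta>(2)] pull_principal[OF x \<theta>(2)]])
      (simp_all add: pull_dedge[OF x \<theta>(1)] pull_dedge[OF x \<theta>(2)]
        pull_dtriangle[OF x \<theta>(1)] pull_dtriangle[OF x \<theta>(2)] same_face_def
        dedge_def[of A x k k] dedge_def[of A x k' k'] dtriangle_def[of A x _ k k] dtriangle_def[of A x _ k' k'])
  then have "pull (street_nerve B) 3 n ?\<theta> (F n x) = pull (street_nerve B) 3 n ?\<theta>' (F n x)"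
    using F \<theta> x unfolding sset_morphism_def street_nerve_simps(1) by metis
  then show ?thesis
    using pull_dedge[OF Fx \<theta>(1), of 0 1] pull_dedge[OF Fx \<theta>(1), of 0 2] pull_dedge[OF Fx \<theta>(1), of 1 2]
      pull_dedge[OF Fx \<theta>(2), of 0 1] pull_dedge[OF Fx \<theta>(2), of 0 2] pull_dedge[OF Fx \<theta>(2), of 1 2]
      pull_dtriangle[OF Fx \<theta>(1), of 0 1 2] pull_dtriangle[OF Fx \<theta>(2), of 0 1 2]
    by (simp add: same_face_def)
qed

section \<open>The defining simplices\<close>

text \<open>
  Up to the names of the cells, the simplices of (i) and (iii) are those of \<open>type_i\<close> and \<open>type_iii\<close>:
  the remaining equations between triangles follow from the triviality of the principal cell.
  In \<open>type_ii\<close>, however, \<open>\<alpha>\<^sub>1\<^sub>2\<^sub>3\<close> is arbitrary, whereas (ii) requires it to be an identity.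
\<close>

definition type_i :: "'a ocat \<Rightarrow> (nat \<Rightarrow> table \<Rightarrow> 'a) \<Rightarrow> bool" where
  "type_i A x \<longleftrightarrow> x \<in> omega_hom (oriental 3) A \<and> trivial_principal A x \<and>
     same_face A x (0, 2, 3) (0, 3, 3) \<and> same_face A x (0, 1, 3) (0, 0, 3)"

definition type_ii :: "'a ocat \<Rightarrow> (nat \<Rightarrow> table \<Rightarrow> 'a) \<Rightarrow> bool" where
  "type_ii A x \<longleftrightarrow> x \<in> omega_hom (oriental 3) A \<and> trivial_principal A x \<and>
     same_face A x (0, 1, 2) (0, 0, 2)"

definition type_iii :: "'a ocat \<Rightarrow> (nat \<Rightarrow> table \<Rightarrow> 'a) \<Rightarrow> bool" where
  "type_iii A x \<longleftrightarrow> x \<in> omega_hom (oriental 3) A \<and> trivial_principal A x \<and>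
     same_face A x (1, 2, 3) (1, 3, 3)"

lemma simplex_i_imp_type_i:
  assumes A: "strict_omega_category A" and "arrow A 0 f a a'" "simplex_i A a a' f g \<alpha> x"
  shows "type_i A x"
proof -
  interpret strict_omega_category A by (rule A)
  have x: "x \<in> omega_hom (oriental 3) A"
    using assms(3) by (simp add: simplex_i_def street_nerve_simps)
  have "a \<in> cells A 0" "a' \<in> cells A 0"
    using assms(2) src_cell[of f 0] tgt_cell[of f 0] by (auto simp: arrow_def)
  then have "x 0 (atom [0]) = a" "x 0 (atom [3]) = a'"
    using edge_arrow[OF x, of 0 1] edge_arrow[OF x, of 2 3] assms(3) src_idn tgt_idn
    by (auto simp: arrow_def simplex_i_def)
  then show ?thesis
    using assms(3) x by (simp add: type_i_def simplex_i_def same_face_def dedge_def dtriangle_def)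
qed

lemma simplex_ii_imp_type_ii:
  assumes A: "strict_omega_category A" and "arrow A 0 g a a'" "simplex_ii A a f g h \<alpha> x"
  shows "type_ii A x"
proof -
  interpret strict_omega_category A by (rule A)
  have x: "x \<in> omega_hom (oriental 3) A"
    using assms(3) by (simp add: simplex_ii_def street_nerve_simps)
  have "a \<in> cells A 0"
    using assms(2) src_cell[of g 0] by (auto simp: arrow_def)
  then have "x 0 (atom [0]) = a"
    using edge_arrow[OF x, of 0 1] assms(3) src_idn by (simp add: arrow_def simplex_ii_def)
  then show ?thesis
    using assms(3) x by (simp add: type_ii_def simplex_ii_def same_face_def dedge_def dtriangle_def)
qed

lemma simplex_iii_imp_type_iii:
  assumes A: "strict_omega_category A" and "arrow A 0 i a' a''" "simplex_iii A a'' f g h i \<alpha> \<beta> x"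
  shows "type_iii A x"
proof -
  interpret strict_omega_category A by (rule A)
  have x: "x \<in> omega_hom (oriental 3) A"
    using assms(3) by (simp add: simplex_iii_def street_nerve_simps)
  have "a'' \<in> cells A 0"
    using assms(2) tgt_cell[of i 0] by (auto simp: arrow_def)
  then have "x 0 (atom [3]) = a''"
    using edge_arrow[OF x, of 2 3] assms(3) tgt_idn by (simp add: arrow_def simplex_iii_def)
  then show ?thesis
    using assms(3) x by (simp add: type_iii_def simplex_iii_def same_face_def dedge_def dtriangle_def)
qed

section \<open>From coincidences of faces to the cells named in (i) and (iii)\<close>

context strict_omega_category
begin

lemma cmp_idn_vertex:
  assumes "v \<in> cells C 0"
  shows "composable C 0 1 (idn C 0 v) x \<Longrightarrow> cmp C 0 1 (idn C 0 v) x = x"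
    "composable C 0 1 x (idn C 0 v) \<Longrightarrow> cmp C 0 1 x (idn C 0 v) = x"
    "composable C 0 2 (idn C 1 (idn C 0 v)) x \<Longrightarrow> cmp C 0 2 (idn C 1 (idn C 0 v)) x = x"
    "composable C 0 2 x (idn C 1 (idn C 0 v)) \<Longrightarrow> cmp C 0 2 x (idn C 1 (idn C 0 v)) = x"
  using assms cmp_iidn_left[of 0 1 v x] cmp_iidn_right[of 0 1 x v]
    cmp_iidn_left[of 0 2 v x] cmp_iidn_right[of 0 2 x v]
  by (simp_all add: iidn_numeral)

lemma cmp_idn_edge:
  assumes "f \<in> cells C 1"
  shows "composable C 1 2 (idn C 1 f) x \<Longrightarrow> cmp C 1 2 (idn C 1 f) x = x"
    "composable C 1 2 x (idn C 1 f) \<Longrightarrow> cmp C 1 2 x (idn C 1 f) = x"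
  using assms cmp_iidn_left[of 1 2 f x] cmp_iidn_right[of 1 2 x f]
  by (simp_all add: iidn_numeral)

lemma edge_composable:
  assumes "x \<in> omega_hom (oriental n) C" "i < j" "j < k" "k \<le> n"
  shows "composable C 0 1 (edge x j k) (edge x i j)"
  using assms hom_composable[OF assms(1), of 0 1 "atom [j, k]" "atom [i, j]"]
  by (simp add: edge_def atom_tab composable_tab)

lemma type_i_imp_simplex_i:
  assumes "type_i C x"
  defines "a \<equiv> x 0 (atom [0])" and "a' \<equiv> x 0 (atom [3])" and "f \<equiv> edge x 0 3"
    and "g \<equiv> edge x 1 2" and "\<alpha> \<equiv> triangle x 0 1 2"
  shows "arrow C 0 f a a' \<and> arrow C 0 g a a' \<and> arrow C 1 \<alpha> f g \<and> simplex_i C a a' f g \<alpha> x"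
proof -
  have x: "x \<in> omega_hom (oriental 3) C" "trivial_principal C x"
    and e: "edge x 0 1 = idn C 0 a" "edge x 2 3 = idn C 0 a'" "edge x 0 2 = f" "edge x 1 3 = f"
    and t: "triangle x 0 2 3 = idn C 1 f" "triangle x 0 1 3 = idn C 1 f"
    using assms(1) by (simp_all add: type_i_def same_face_def dedge_def dtriangle_def a_def a'_def f_def)
  have v: "a \<in> cells C 0" "a' \<in> cells C 0"
    using vertex_cell[OF x(1)] by (simp_all add: a_def a'_def)
  have "x 0 (atom [1]) = a" "x 0 (atom [2]) = a'"
    using edge_arrow[OF x(1), of 0 1] edge_arrow[OF x(1), of 2 3] e v
    by (auto simp: arrow_def tgt_idn src_idn)
  then have arr: "arrow C 0 f a a'" "arrow C 0 g a a'"
    using edge_arrow[OF x(1), of 0 3] edge_arrow[OF x(1), of 1 2] by (simp_all add: a_def a'_def f_def g_def)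
  then have fg: "f \<in> cells C 1" by (simp add: arrow_def)
  have "arrow C 1 \<alpha> f g"
    using triangle_arrow[OF x(1), of 0 1 2] edge_composable[OF x(1), of 0 1 2] e cmp_idn_vertex(2)[OF v(1), of g]
    by (simp add: g_def \<alpha>_def)
  \<comment> \<open>The whiskers 01 and 23 and the triangles 013 and 023 are identities, so the
    equation of the principal cell reduces to an equality of the other two triangles.\<close>
  moreover have "triangle x 1 2 3 = \<alpha>"
    using trivial_principal_imp_eq[OF strict_omega_category_axioms x] e t
    by (simp add: cmp_idn_vertex[simplified] v cmp_idn_edge[simplified] fg[simplified] \<alpha>_def)
  ultimately show ?thesis
    using arr x e t by (simp add: simplex_i_def street_nerve_simps f_def g_def \<alpha>_def)
qed

lemma type_iii_imp_simplex_iii: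
  assumes "type_iii C x"
  defines "a \<equiv> x 0 (atom [0])" and "a' \<equiv> x 0 (atom [1])" and "a'' \<equiv> x 0 (atom [3])"
    and "f \<equiv> edge x 0 3" and "g \<equiv> edge x 0 2" and "h \<equiv> edge x 0 1" and "i \<equiv> edge x 1 2"
    and "\<alpha> \<equiv> triangle x 0 2 3" and "\<beta> \<equiv> triangle x 0 1 2"
  shows "arrow C 0 h a a' \<and> arrow C 0 i a' a'' \<and> arrow C 1 \<alpha> f g \<and>
    arrow C 1 \<beta> g (cmp C 0 1 i h) \<and> simplex_iii C a'' f g h i \<alpha> \<beta> x"
proof -
  have x: "x \<in> omega_hom (oriental 3) C" "trivial_principal C x"
    and e: "edge x 1 3 = i" "edge x 2 3 = idn C 0 a''"
    and t: "triangle x 1 2 3 = idn C 1 i"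
    using assms(1) by (simp_all add: type_iii_def same_face_def dedge_def dtriangle_def a''_def i_def)
  have v: "a'' \<in> cells C 0"
    using vertex_cell[OF x(1)] by (simp add: a''_def)
  have "x 0 (atom [2]) = a''"
    using edge_arrow[OF x(1), of 2 3] e v by (simp add: arrow_def src_idn)
  then have arr: "arrow C 0 h a a'" "arrow C 0 i a' a''"
    using edge_arrow[OF x(1), of 0 1] edge_arrow[OF x(1), of 1 2] by (simp_all add: a_def a'_def h_def i_def)
  have comp: "composable C 0 1 i h"
    using edge_composable[OF x(1), of 0 1 2] by (simp add: i_def h_def)
  have \<alpha>: "arrow C 1 \<alpha> f g"
    using triangle_arrow[OF x(1), of 0 2 3] edge_composable[OF x(1), of 0 2 3] e cmp_idn_vertex(1)[OF v, of g]
    by (simp add: g_def \<alpha>_def f_def)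
  have \<beta>: "arrow C 1 \<beta> g (cmp C 0 1 i h)"
    using triangle_arrow[OF x(1), of 0 1 2] by (simp add: g_def \<beta>_def i_def h_def)
  \<comment> \<open>The whiskered identity in the target of the principal cell is itself an
    identity, so that side reduces to the triangle 013 and the other to \<beta> after
    \<alpha>.\<close>
  have "cmp C 0 2 (idn C 1 i) (idn C 1 h) = idn C 1 (cmp C 0 1 i h)"
    using idn_cmp[OF comp] by (simp add: numeral_2_eq_2)
  then have "triangle x 0 1 3 = cmp C 1 2 \<beta> \<alpha>"
    using trivial_principal_imp_eq[OF strict_omega_category_axioms x] e t cmp_cell[OF comp]
    by (simp add: cmp_idn_vertex[simplified] v cmp_idn_edge[simplified] \<alpha>_def \<beta>_def h_def)
  then show ?thesis
    using arr \<alpha> \<beta> x e t by (simp add: simplex_iii_def street_nerve_simps f_def g_def h_def i_def \<alpha>_def \<beta>_def)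
qed

end

section \<open>The 4-simplex over a simplex of type (ii)\<close>

text \<open>
  In the simplices to which this is applied the edge \<open>01\<close> is an identity, so the edges \<open>12\<close> and \<open>13\<close> of the
  fourth oriental, whose source is sent to \<open>0\<close>, may be sent to their composites with \<open>01\<close>.
  All tuples that are not listed are sent to zero.
\<close>

definition collapse_table :: "(nat list \<times> chain) list" where
  "collapse_table =
     [([0], frag_of [0]), ([1], frag_of [0]), ([2], frag_of [2]), ([3], frag_of [3]), ([4], frag_of [3]),
      ([0, 2], frag_of [0, 1] + frag_of [1, 2]), ([1, 2], frag_of [0, 1] + frag_of [1, 2]),
      ([1, 3], frag_of [0, 1] + frag_of [1, 3]),
      ([0, 3], frag_of [0, 3]), ([0, 4], frag_of [0, 3]), ([1, 4], frag_of [0, 3]),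
      ([2, 3], frag_of [2, 3]), ([2, 4], frag_of [2, 3]),
      ([0, 1, 3], frag_of [0, 1, 3]), ([1, 3, 4], frag_of [0, 1, 3]), ([1, 2, 3], frag_of [1, 2, 3]),
      ([0, 2, 3], frag_of [0, 1, 3] + frag_of [1, 2, 3]),
      ([0, 2, 4], frag_of [0, 1, 3] + frag_of [1, 2, 3]),
      ([1, 2, 4], frag_of [0, 1, 3] + frag_of [1, 2, 3])]"

definition collapse :: "nat list \<Rightarrow> chain" where
  "collapse \<sigma> = (case map_of collapse_table \<sigma> of None \<Rightarrow> 0 | Some c \<Rightarrow> c)"

lemma collapse_not_distinct:
  assumes "\<not> distinct \<sigma>"
  shows "collapse \<sigma> = 0"
proof -
  have "map_of collapse_table \<sigma> = None"
    unfolding map_of_eq_None_iff using assms by (auto simp: collapse_table_def)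
  then show ?thesis by (simp add: collapse_def)
qed

lemma collapse_simps:
  "collapse [0] = frag_of [0]"
  "collapse [1] = frag_of [0]"
  "collapse [2] = frag_of [2]"
  "collapse [3] = frag_of [3]"
  "collapse [4] = frag_of [3]"
  "collapse [0, 1] = 0"
  "collapse [0, 2] = frag_of [0, 1] + frag_of [1, 2]"
  "collapse [0, 3] = frag_of [0, 3]"
  "collapse [0, 4] = frag_of [0, 3]"
  "collapse [1, 2] = frag_of [0, 1] + frag_of [1, 2]"
  "collapse [1, 3] = frag_of [0, 1] + frag_of [1, 3]"
  "collapse [1, 4] = frag_of [0, 3]"
  "collapse [2, 3] = frag_of [2, 3]"
  "collapse [2, 4] = frag_of [2, 3]"
  "collapse [3, 4] = 0"
  "collapse [0, 1, 2] = 0"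
  "collapse [0, 1, 3] = frag_of [0, 1, 3]"
  "collapse [0, 1, 4] = 0"
  "collapse [0, 2, 3] = frag_of [0, 1, 3] + frag_of [1, 2, 3]"
  "collapse [0, 2, 4] = frag_of [0, 1, 3] + frag_of [1, 2, 3]"
  "collapse [0, 3, 4] = 0"
  "collapse [1, 2, 3] = frag_of [1, 2, 3]"
  "collapse [1, 2, 4] = frag_of [0, 1, 3] + frag_of [1, 2, 3]"
  "collapse [1, 3, 4] = frag_of [0, 1, 3]"
  "collapse [2, 3, 4] = 0"
  "collapse [0, 1, 2, 3] = 0"
  "collapse [0, 1, 2, 4] = 0"
  "collapse [0, 1, 3, 4] = 0"
  "collapse [0, 2, 3, 4] = 0"
  "collapse [1, 2, 3, 4] = 0"
  "collapse [0, 1, 2, 3, 4] = 0"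
  by (simp_all add: collapse_def collapse_table_def)

lemma tuples_4_subset:
  "tuples 4 0 \<subseteq> {[0], [1], [2], [3], [4]}"
  "tuples 4 1 \<subseteq> {[0, 1], [0, 2], [0, 3], [0, 4], [1, 2], [1, 3], [1, 4], [2, 3], [2, 4], [3, 4]}"
  "tuples 4 2 \<subseteq> {[0, 1, 2], [0, 1, 3], [0, 1, 4], [0, 2, 3], [0, 2, 4], [0, 3, 4], [1, 2, 3], [1, 2, 4], [1, 3, 4], [2, 3, 4]}"
  "tuples 4 3 \<subseteq> {[0, 1, 2, 3], [0, 1, 2, 4], [0, 1, 3, 4], [0, 2, 3, 4], [1, 2, 3, 4]}"
  "tuples 4 4 \<subseteq> {[0, 1, 2, 3, 4]}"
proof -
  show "tuples 4 0 \<subseteq> {[0], [1], [2], [3], [4]}" (is "_ \<subseteq> ?S")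
  proof
    fix \<sigma> assume \<sigma>: "\<sigma> \<in> tuples 4 0"
    obtain i where *: "\<sigma> = [i]"  "i \<le> 4"
      using \<sigma> tuples_1 by blast
    have i: "i = 0 \<or> i = 1 \<or> i = 2 \<or> i = 3 \<or> i = 4" using * by linarith
    from i *(2-) show "\<sigma> \<in> ?S" unfolding *(1) by (elim disjE) simp_all
  qed
  show "tuples 4 1 \<subseteq> {[0, 1], [0, 2], [0, 3], [0, 4], [1, 2], [1, 3], [1, 4], [2, 3], [2, 4], [3, 4]}" (is "_ \<subseteq> ?S")
  proof
    fix \<sigma> assume \<sigma>: "\<sigma> \<in> tuples 4 1"
    obtain i j where *: "\<sigma> = [i, j]" "i < j" "j \<le> 4"
      using \<sigma> tuples_2 by blast
    have i: "i = 0 \<or> i = 1 \<or> i = 2 \<or> i = 3" using * by linarith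
    have j: "j = 1 \<or> j = 2 \<or> j = 3 \<or> j = 4" using * by linarith
    from i j *(2-) show "\<sigma> \<in> ?S" unfolding *(1) by (elim disjE) simp_all
  qed
  show "tuples 4 2 \<subseteq> {[0, 1, 2], [0, 1, 3], [0, 1, 4], [0, 2, 3], [0, 2, 4], [0, 3, 4], [1, 2, 3], [1, 2, 4], [1, 3, 4], [2, 3, 4]}" (is "_ \<subseteq> ?S")
  proof
    fix \<sigma> assume \<sigma>: "\<sigma> \<in> tuples 4 2"
    obtain i j k where *: "\<sigma> = [i, j, k]" "i < j" "j < k" "k \<le> 4"
      using \<sigma> tuples_3 by blast
    have i: "i = 0 \<or> i = 1 \<or> i = 2" using * by linarith
    have j: "j = 1 \<or> j = 2 \<or> j = 3" using * by linarith
    have k: "k = 2 \<or> k = 3 \<or> k = 4" using * by linarith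
    from i j k *(2-) show "\<sigma> \<in> ?S" unfolding *(1) by (elim disjE) simp_all
  qed
  show "tuples 4 3 \<subseteq> {[0, 1, 2, 3], [0, 1, 2, 4], [0, 1, 3, 4], [0, 2, 3, 4], [1, 2, 3, 4]}" (is "_ \<subseteq> ?S")
  proof
    fix \<sigma> assume \<sigma>: "\<sigma> \<in> tuples 4 3"
    obtain i j k l where *: "\<sigma> = [i, j, k, l]" "i < j" "j < k" "k < l" "l \<le> 4"
      using \<sigma> tuples_4 by blast
    have i: "i = 0 \<or> i = 1" using * by linarith
    have j: "j = 1 \<or> j = 2" using * by linarith
    have k: "k = 2 \<or> k = 3" using * by linarith
    have l: "l = 3 \<or> l = 4" using * by linarith
    from i j k l *(2-) show "\<sigma> \<in> ?S" unfolding *(1) by (elim disjE) simp_all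
  qed
  show "tuples 4 4 \<subseteq> {[0, 1, 2, 3, 4]}" (is "_ \<subseteq> ?S")
  proof
    fix \<sigma> assume \<sigma>: "\<sigma> \<in> tuples 4 4"
    obtain i j k l m where *: "\<sigma> = [i, j, k, l, m]" "i < j" "j < k" "k < l" "l < m" "m \<le> 4"
      using \<sigma> by (auto simp: tuples_def length_Suc_conv eval_nat_numeral)
    have i: "i = 0" using * by linarith
    have j: "j = 1" using * by linarith
    have k: "k = 2" using * by linarith
    have l: "l = 3" using * by linarith
    have m: "m = 4" using * by linarith
    from i j k l m show "\<sigma> \<in> ?S" unfolding *(1) by simp
  qed
qed

text \<open>A finite check over the 31 increasing tuples in [4].\<close>

lemma directed_map_collapse: "directed_map 4 3 collapse"
proof -
  have p: "p = 0 \<or> p = 1 \<or> p = 2 \<or> p = 3 \<or> p = 4" if "\<sigma> \<in> tuples 4 p" for p \<sigma>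
    using that tuples_empty[of 4 p] by (cases "p \<le> 4") auto
  note eval = collapse_simps[simplified] frag_extend_diff frag_extend_add pos_chains.plus
  have 0: "collapse \<sigma> \<in> pos_chains 3 0" "augm (collapse \<sigma>) = 1" if "\<sigma> \<in> tuples 4 0" for \<sigma>
    using subsetD[OF tuples_4_subset(1) that] by (auto simp: eval)
  have 1: "collapse \<sigma> \<in> pos_chains 3 1" "bdry (collapse \<sigma>) = frag_extend collapse (bdry (frag_of \<sigma>))"
    if "\<sigma> \<in> tuples 4 1" for \<sigma>
    using subsetD[OF tuples_4_subset(2) that] by (auto simp: eval)
  have 2: "collapse \<sigma> \<in> pos_chains 3 2" "bdry (collapse \<sigma>) = frag_extend collapse (bdry (frag_of \<sigma>))"
    if "\<sigma> \<in> tuples 4 2" for \<sigma>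
    using subsetD[OF tuples_4_subset(3) that] by (auto simp: eval)
  have 3: "collapse \<sigma> \<in> pos_chains 3 3" "bdry (collapse \<sigma>) = frag_extend collapse (bdry (frag_of \<sigma>))"
    if "\<sigma> \<in> tuples 4 3" for \<sigma>
    using subsetD[OF tuples_4_subset(4) that] by (auto simp: eval)
  have 4: "collapse \<sigma> \<in> pos_chains 3 4" "bdry (collapse \<sigma>) = frag_extend collapse (bdry (frag_of \<sigma>))"
    if "\<sigma> \<in> tuples 4 4" for \<sigma>
    using subsetD[OF tuples_4_subset(5) that] by (auto simp: eval)
  have pos: "collapse \<sigma> \<in> pos_chains 3 p" if "\<sigma> \<in> tuples 4 p" for p \<sigma>
    using p[OF that] that 0 1 2 3 4 by (elim disjE; hypsubst) blast+
  have bd: "bdry (collapse \<sigma>) = frag_extend collapse (bdry (frag_of \<sigma>))"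
    if \<sigma>: "\<sigma> \<in> tuples 4 (Suc p)" for p \<sigma>
  proof -
    consider "Suc p = 1" | "Suc p = 2" | "Suc p = 3" | "Suc p = 4"
      using p[OF \<sigma>] by auto
    then show ?thesis
      using \<sigma> 1(2) 2(2) 3(2) 4(2) by cases (simp_all only:)
  qed
  show ?thesis
    unfolding directed_map_def using 0(2) pos bd by blast
qed

lemma type_ii_filler:
  assumes A: "strict_omega_category A" and "type_ii A x"
  defines "X \<equiv> pullback 4 collapse x"
  shows "X \<in> omega_hom (oriental 4) A"
    and "pull (street_nerve A) 3 4 ((!) [0, 1, 2, 3]) X = x"
    and "pull (street_nerve A) 3 4 ((!) [0, 1, 2, 4]) X = pull (street_nerve A) 3 4 ((!) [0, 0, 2, 4]) X"
    and "pull (street_nerve A) 3 4 ((!) [0, 2, 3, 4]) X = pull (street_nerve A) 3 4 ((!) [0, 2, 3, 3]) X"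
    and "type_i A (pull (street_nerve A) 3 4 ((!) [0, 1, 3, 4]) X)"
    and "type_iii A (pull (street_nerve A) 3 4 ((!) [1, 2, 3, 4]) X)"
    and "same_face A X (0, 3, 4) (0, 4, 4)"
proof -
  interpret strict_omega_category A by (rule A)
  let ?O = "oriental 3"
  have x: "x \<in> omega_hom ?O A" and triv: "trivial_principal A x"
    and same: "same_face A x (0, 1, 2) (0, 0, 2)"
    using assms(2) by (auto simp: type_ii_def)
  show X: "X \<in> omega_hom (oriental 4) A"
    unfolding X_def by (rule pullback_hom[OF directed_map_collapse x])
  note e = pullback_dedge[OF x directed_map_collapse collapse_not_distinct, folded X_def]
    and t = pullback_dtriangle[OF x directed_map_collapse collapse_not_distinct, folded X_def]
    and eval = collapse_simps[simplified] collapse_not_distinct add.commute add.left_commute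
  let ?\<theta> = "\<lambda>a b c d. (!) [a, b, c, d]" and ?P = "pull (street_nerve A) 3 4"
  note \<theta> = simplex_map_nth[of _ _ _ _ 4]
  \<comment> \<open>Every tetrahedron is sent to zero by \<open>collapse\<close>, so its atom goes
    to a table with zero top entry, which is an identity. If vertices repeat, the pulled-back
    simplex is degenerate.\<close>
  have trivX: "trivial_principal A (?P (?\<theta> a b c d) X)"
    if "a \<le> b" "b \<le> c" "c \<le> d" "d \<le> 4" for a b c d
  proof (cases "sorted_wrt (<) [a, b, c, d]")
    case True
    then have abcd: "a < b" "b < c" "c < d" by auto
    have "[a, b, c, d] \<in> tuples 4 3"
      using abcd that by simp
    from subsetD[OF tuples_4_subset(4) this] have "collapse [a, b, c, d] = 0"
      by (auto simp: eval)
    moreover have "tuple_map (?\<theta> a b c d) [0, 1, 2, 3] = frag_of [a, b, c, d]"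
      using abcd by (simp add: tuple_map_def)
    moreover have "atom [a, b, c, d] \<in> cells (oriental 4) 3"
      using abcd that by (simp add: atom_cells)
    moreover have "lift collapse (atom [a, b, c, d]) 3 False = collapse [a, b, c, d]"
      using abcd by (simp add: atom_4 lift_def tab_def)
    ultimately have "trivial_cell A 2 (X 3 (atom [a, b, c, d]))"
      using hom_trivial[OF x cells_pred[of "lift collapse (atom [a, b, c, d])" 3 2]]
        lift_cell[OF directed_map_collapse, of "atom [a, b, c, d]" 3]
      by (simp add: X_def pullback_apply numeral_3_eq_3 numeral_2_eq_2)
    then show ?thesis
      using pull_principal_face[OF X \<theta>, of a b c d] True that by simp
  next
    case False
    then show ?thesis
      using pull_principal[OF X \<theta>, of a b c d] that by simp
  qed
  note pulls = pull_dedge[OF X \<theta>] pull_dtriangle[OF X \<theta>]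
  show "?P (?\<theta> 0 1 2 4) X = ?P (?\<theta> 0 0 2 4) X"
    by (rule nerve_3_eqI_dedge[OF A pull_hom[OF X \<theta>] trivX pull_hom[OF X \<theta>] trivX])
      (simp_all add: pulls e t eval)
  show "?P (?\<theta> 0 2 3 4) X = ?P (?\<theta> 0 2 3 3) X"
    by (rule nerve_3_eqI_dedge[OF A pull_hom[OF X \<theta>] trivX pull_hom[OF X \<theta>] trivX])
      (simp_all add: pulls e t eval)
  show "same_face A X (0, 3, 4) (0, 4, 4)"
    by (simp add: same_face_def e t eval)
  show "type_i A (?P (?\<theta> 0 1 3 4) X)"
    using pull_hom[OF X \<theta>, of 0 1 3 4] trivX[of 0 1 3 4] pull_same_face[OF X \<theta>, of 0 1 3 4]
    by (simp add: type_i_def) (simp add: same_face_def e t eval)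
  show "type_iii A (?P (?\<theta> 1 2 3 4) X)"
    using pull_hom[OF X \<theta>, of 1 2 3 4] trivX[of 1 2 3 4] pull_same_face[OF X \<theta>, of 1 2 3 4]
    by (simp add: type_iii_def) (simp add: same_face_def e t eval)
  show "?P (?\<theta> 0 1 2 3) X = x"
  proof -
    let ?e01 = "atom [0, 1]"
    have x01: "x 1 ?e01 = idn A 0 (x 0 (atom [0]))" and e12: "dedge A x 1 2 = dedge A x 0 2"
      and t012: "dtriangle A x 0 1 2 = idn A 1 (dedge A x 0 2)"
      using same by (simp_all add: same_face_def dedge_def edge_def dtriangle_def)
    have v: "x 0 (atom [0]) \<in> cells A 0" using vertex_cell[OF x] by simp
    have x01': "x 2 ?e01 = idn A 1 (idn A 0 (x 0 (atom [0])))"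
      using hom_whisker_idn(1)[OF x, of ?e01] x01 by (simp add: atom_cells[simplified])
    \<comment> \<open>Composing with the edge 01 is invisible in \<open>x\<close>, where that edge
      is an identity; this undoes the detours through 01 in \<open>collapse\<close>.\<close>
    have whisker1: "x 1 (cmp ?O 0 1 c ?e01) = x 1 c" if "composable ?O 0 1 c ?e01" for c
      using omega_homD(5)[OF x that] hom_composable[OF x that] x01 cmp_idn_vertex(2)[OF v] by simp
    have whisker2: "x 2 (cmp ?O 0 2 c ?e01) = x 2 c" if "composable ?O 0 2 c ?e01" for c
      using omega_homD(5)[OF x that] hom_composable[OF x that] x01' cmp_idn_vertex(4)[OF v] by simp
    have "dedge A x 0 1 = dedge A x 0 0"
      using same by (simp add: same_face_def)
    then have d: "dedge A X 0 1 = dedge A x 0 1" "dedge A X 0 3 = dedge A x 0 3" "dedge A X 2 3 = dedge A x 2 3"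
      using dedge_eq(1)[OF x, of 0 0] dedge_eq(1)[OF x, of 0 3] dedge_eq(1)[OF x, of 2 3]
      by (simp_all add: e eval tuple_chain_def)
    have "composable ?O 0 1 (atom [1, 2]) ?e01" "composable ?O 0 1 (atom [1, 3]) ?e01"
      by (simp_all add: atom_tab composable_tab)
    from whisker1[OF this(1)] whisker1[OF this(2)]
    have d12: "dedge A X 1 2 = dedge A x 1 2" and d13: "dedge A X 1 3 = dedge A x 1 3"
      using dedge_eq(1)[OF x, of 1 2] dedge_eq(1)[OF x, of 1 3]
      by (simp_all add: e eval tuple_chain_def atom_tab cmp_tab)
    have d02: "dedge A X 0 2 = dedge A x 0 2"
      using d12 e12 by (simp add: e eval)
    have "dtriangle A X 0 1 2 = idn A 1 (dedge A X 0 2)"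
    proof -
      have "tab1 (frag_of [0]) (frag_of [2]) (frag_of [0, 1] + frag_of [1, 2]) \<in> cells ?O 1"
        by (simp add: tab_in_cells pos_chains.plus)
      from hom_whisker_idn(1)[OF x this] show ?thesis
        by (simp add: e t eval)
    qed
    then have "dtriangle A X 0 1 2 = dtriangle A x 0 1 2"
      using d02 t012 by simp
    moreover have "dtriangle A X 0 1 3 = dtriangle A x 0 1 3"
      using dtriangle_eq(1)[OF x, of 0 1 3] by (simp add: t eval tuple_chain_def)
    moreover
    let ?c = "cmp ?O 0 2 (atom [1, 2, 3]) ?e01"
    have c: "composable ?O 0 2 (atom [1, 2, 3]) ?e01" "composable ?O 1 2 ?c (atom [0, 1, 3])"
      by (simp_all add: atom_tab composable_tab cmp_tab pos_chains.plus algebra_simps)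
    have x123: "x 2 ?c = dtriangle A x 1 2 3"
      using whisker2[OF c(1)] by (simp add: dtriangle_def triangle_def)
    then have "dtriangle A X 1 2 3 = dtriangle A x 1 2 3"
      by (simp add: t eval atom_tab cmp_tab)
    \<comment> \<open>Here \<open>collapse\<close> puts the composite of 123 after 013. The equation
      of the principal cell of \<open>x\<close>, with 01 and 012 identities, says that this
      composite is 023.\<close>
    moreover have "dtriangle A X 0 2 3 = dtriangle A x 0 2 3"
    proof -
      have comp: "composable A 0 1 (edge x 2 3) (edge x 0 2)"
        by (rule edge_composable[OF x]) simp_all
      have "dtriangle A X 0 2 3 = x 2 (cmp ?O 1 2 ?c (atom [0, 1, 3]))"
        by (simp add: t eval atom_tab cmp_tab)
      also have "\<dots> = cmp A 1 2 (triangle x 1 2 3) (triangle x 0 1 3)"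
        using omega_homD(5)[OF x c(2)] x123 by (simp add: dtriangle_def triangle_def)
      also have "\<dots> = cmp A 1 2 (cmp A 0 2 (idn A 1 (edge x 2 3)) (triangle x 0 1 2)) (triangle x 0 2 3)"
        using trivial_principal_imp_eq(1,5)[OF A x triv] x01 v
        by (simp add: edge_def cmp_idn_vertex[simplified])
      also have "\<dots> = triangle x 0 2 3"
      proof -
        have "cmp A 0 2 (idn A 1 (edge x 2 3)) (triangle x 0 1 2) = idn A 1 (cmp A 0 1 (edge x 2 3) (edge x 0 2))"
          using idn_cmp[OF comp] t012 by (simp add: dtriangle_def dedge_def numeral_2_eq_2)
        then show ?thesis
          using trivial_principal_imp_eq(2)[OF A x triv] cmp_idn_edge(1)[OF cmp_cell[OF comp]] by simp
      qed
      finally show ?thesis by (simp add: dtriangle_def)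
    qed
    ultimately show ?thesis
      by (intro nerve_3_eqI_dedge[OF A pull_hom[OF X \<theta>] trivX x triv])
        (simp_all add: pulls d[simplified] d12[simplified] d02 d13[simplified])
  qed
qed

section \<open>Preservation of the three types\<close>

locale preserves_i_iii =
  fixes A :: "'a ocat" and B :: "'b ocat" and F
  assumes A: "strict_omega_category A"
    and B: "strict_3_category B"
    and F: "sset_morphism (street_nerve A) (street_nerve B) F"
    and F_i: "type_i A x \<Longrightarrow> trivial_principal B (F 3 x)"
    and F_iii: "type_iii A x \<Longrightarrow> trivial_principal B (F 3 x)"
begin

lemma hom: "x \<in> omega_hom (oriental n) A \<Longrightarrow> F n x \<in> omega_hom (oriental n) B"
  using F by (simp add: sset_morphism_def street_nerve_simps)

lemma pull: "x \<in> omega_hom (oriental n) A \<Longrightarrow> simplex_map 3 n \<theta> \<Longrightarrow>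
  F 3 (pull (street_nerve A) 3 n \<theta> x) = pull (street_nerve B) 3 n \<theta> (F n x)"
  using F unfolding sset_morphism_def street_nerve_simps(1) by blast

lemma type_i: "type_i A x \<Longrightarrow> type_i B (F 3 x)"
  using F_i hom morphism_same_face[OF A F, of x 3 0 2 3 0 3 3]
    morphism_same_face[OF A F, of x 3 0 1 3 0 0 3] unfolding type_i_def by simp

lemma type_iii: "type_iii A x \<Longrightarrow> type_iii B (F 3 x)"
  using F_iii hom morphism_same_face[OF A F, of x 3 1 2 3 1 3 3] unfolding type_iii_def by simp

text \<open>The 4-simplex is built in the nerve of \<open>A\<close>, but it is its image that must
  have an identity as principal cell; so \<open>trivial_face_0123\<close> is applied in
  \<open>B\<close>.\<close>

lemma type_ii:
  assumes "type_ii A x"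
  shows "type_ii B (F 3 x)"
proof -
  define X where "X = pullback 4 collapse x"
  note X = type_ii_filler[OF A assms, folded X_def]
  note FX = hom[OF X(1)]
  note \<theta> = simplex_map_nth[of _ _ _ _ 4]
  \<comment> \<open>The face 0124 coincides with a pullback along a map that repeats a vertex.
    \<open>F\<close> commutes with pullbacks, so its image is degenerate; the same holds for 0234
    below.\<close>
  have "trivial_principal B (F 3 (pull (street_nerve A) 3 4 ((!) [0, 1, 2, 4]) X))"
    using pull_principal[OF FX \<theta>, of 0 0 2 4] pull[OF X(1) \<theta>, of 0 0 2 4] X(3) by simp
  then have 1: "trivial_cell B 2 (F 4 X 3 (atom [0, 1, 2, 4]))"
    using pull_principal_face[OF FX \<theta>, of 0 1 2 4] pull[OF X(1) \<theta>, of 0 1 2 4] by simp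
  have "trivial_principal B (F 3 (pull (street_nerve A) 3 4 ((!) [0, 2, 3, 4]) X))"
    using pull_principal[OF FX \<theta>, of 0 2 3 3] pull[OF X(1) \<theta>, of 0 2 3 3] X(4) by simp
  then have 2: "trivial_cell B 2 (F 4 X 3 (atom [0, 2, 3, 4]))"
    using pull_principal_face[OF FX \<theta>, of 0 2 3 4] pull[OF X(1) \<theta>, of 0 2 3 4] by simp
  have 3: "trivial_cell B 2 (F 4 X 3 (atom [0, 1, 3, 4]))"
    using pull_principal_face[OF FX \<theta>, of 0 1 3 4] pull[OF X(1) \<theta>, of 0 1 3 4] F_i[OF X(5)] by simp
  have 4: "trivial_cell B 2 (F 4 X 3 (atom [1, 2, 3, 4]))"
    using pull_principal_face[OF FX \<theta>, of 1 2 3 4] pull[OF X(1) \<theta>, of 1 2 3 4] F_iii[OF X(6)] by simp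
  have "same_face B (F 4 X) (0, 3, 4) (0, 4, 4)"
    by (rule morphism_same_face[OF A F X(1) X(7)]) simp_all
  then have "edge (F 4 X) 3 4 = idn B 0 (F 4 X 0 (atom [4]))"
    "triangle (F 4 X) 0 3 4 = idn B 1 (edge (F 4 X) 0 4)"
    by (simp_all add: same_face_def dedge_def dtriangle_def)
  moreover have "edge (F 4 X) 0 4 \<in> cells B 1"
    using edge_arrow[OF FX, of 0 4] by (simp add: arrow_def)
  ultimately have "trivial_cell B 2 (F 4 X 3 (atom [0, 1, 2, 3]))"
    using trivial_face_0123[OF B FX 4 2 3 1 vertex_cell[OF FX, of 4]] by simp
  then have "trivial_principal B (F 3 x)"
    using pull_principal_face[OF FX \<theta>, of 0 1 2 3] pull[OF X(1) \<theta>, of 0 1 2 3] X(2) by simp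
  then show ?thesis
    using assms hom morphism_same_face[OF A F, of x 3 0 1 2 0 0 2] unfolding type_ii_def by simp
qed

end

text \<open>Conditions (i) and (iii) quantify over named cells while the types name none;
  \<open>type_i_imp_simplex_i\<close> and \<open>type_iii_imp_simplex_iii\<close> read these cells
  off the simplex.\<close>

lemma simplicial_oplax_imp_preserves:
  assumes A: "strict_omega_category A" and B: "strict_3_category B"
    and F: "simplicial_oplax_3_morphism A B F"
  shows "preserves_i_iii A B F"
proof (rule preserves_i_iii.intro)
  show "trivial_principal B (F 3 x)" if "type_i A x" for x
    by (rule F[unfolded simplicial_oplax_3_morphism_def, THEN conjunct2, THEN conjunct1, rule_format,
          OF strict_omega_category.type_i_imp_simplex_i[OF A that]])
  show "trivial_principal B (F 3 x)" if "type_iii A x" for x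
    by (rule F[unfolded simplicial_oplax_3_morphism_def, THEN conjunct2, THEN conjunct2, THEN conjunct2,
          rule_format, OF strict_omega_category.type_iii_imp_simplex_iii[OF A that]])
qed (use assms in \<open>auto simp: simplicial_oplax_3_morphism_def\<close>)

theorem theorem3p0p9:
  fixes A :: "'a ocat" and B :: "'b ocat" and C :: "'c ocat"
    and F :: "nat \<Rightarrow> (nat \<Rightarrow> table \<Rightarrow> 'a) \<Rightarrow> (nat \<Rightarrow> table \<Rightarrow> 'b)"
    and G :: "nat \<Rightarrow> (nat \<Rightarrow> table \<Rightarrow> 'b) \<Rightarrow> (nat \<Rightarrow> table \<Rightarrow> 'c)"
  assumes "strict_3_category A" and "strict_3_category B" and "strict_3_category C"
    and "simplicial_oplax_3_morphism A B F"
    and "simplicial_oplax_3_morphism B C G"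
  shows "simplicial_oplax_3_morphism A C (\<lambda>n. G n \<circ> F n)"
proof -
  have A: "strict_omega_category A" and B: "strict_omega_category B"
    using assms(1,2) by (simp_all add: strict_3_category_def)
  interpret F: preserves_i_iii A B F
    by (rule simplicial_oplax_imp_preserves[OF A assms(2,4)])
  interpret G: preserves_i_iii B C G
    by (rule simplicial_oplax_imp_preserves[OF B assms(3,5)])
  have "sset_morphism (street_nerve A) (street_nerve C) (\<lambda>n. G n \<circ> F n)"
    using F.F G.F by (simp add: sset_morphism_def)
  moreover have "trivial_principal C (G 3 (F 3 x))" if "type_i A x" for x
    using G.F_i F.type_i that by blast
  moreover have "trivial_principal C (G 3 (F 3 x))" if "type_ii A x" for x
    using G.type_ii F.type_ii that by (simp add: type_ii_def)
  moreover have "trivial_principal C (G 3 (F 3 x))" if "type_iii A x" for x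
    using G.F_iii F.type_iii that by blast
  ultimately show ?thesis
    unfolding simplicial_oplax_3_morphism_def comp_apply
    using simplex_i_imp_type_i[OF A] simplex_ii_imp_type_ii[OF A] simplex_iii_imp_type_iii[OF A] by meson
qed

end
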